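(* Let $n$ be a positive integer, and let $a,b,k$ be nonnegative integers and $m,n_0$ integers with $0\le m,n_0\le n\le m+n_0$. Let $\mathbf B=(\beta_{ij})_{0\le i,j\le n}$ be the matrix with $\beta_{ii}=0$, $\beta_{0j}=b$ for $1\le j\le n$, $\beta_{i0}=a$ for $1\le i\le n-m$, $\beta_{i0}=a+1$ for $n-m<i\le n$, and for $1\le i\ne j\le n$: $\beta_{ij}=k+1$ if both $i,j>n_0$, and $\beta_{ij}=k$ otherwise. Define \[ \mathcal{L}_q(x_0,\mathbf x;\mathbf B)=\prod_{0\le i<j\le n}\left(\frac{x_i}{x_j}\right)_{\beta_{ij}}\left(\frac{qx_j}{x_i}\right)_{\beta_{ji}}. \] Then \[ \mathrm{CT}[\mathcal{L}_q(x_0,\mathbf x;\mathbf B)]=\prod_{j=0}^{n-1}\frac{(q)_{a+b+kj+\chi(j>n_0)(j-n_0)+\chi(j\ge n-m)}\,(q)_{kj+\chi(j>n_0)(j-n_0)+k}}{(q)_{a+kj+\chi(j>n_0)(j-n_0)+\chi(j\ge n-m)}\,(q)_{b+kj+\chi(j>n_0)(j-n_0)}\,(q)_k}\times\prod_{j=1}^{n-n_0}\frac{1-q^{(k+1)j}}{1-q^{k+1}}. \]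
   Context: $q,x_0,x_1,\dots,x_n$ are independent indeterminates; $\mathrm{CT}$ denotes the constant term with respect to $x_0,\dots,x_n$ of a Laurent polynomial with coefficients in $\mathbb{Q}(q)$. $(t)_k=(1-t)(1-tq)\cdots(1-tq^{k-1})$ with $(t)_0=1$. $\chi(S)$ equals $1$ if $S$ is true and $0$ otherwise. An empty product equals $1$. *)

theory Defs
  imports
    "HOL-Library.Poly_Mapping"
    "HOL-Computational_Algebra.Polynomial"
    "HOL-Computational_Algebra.Fraction_Field"
begin

type_synonym ratfun = "rat poly fract"

definition q_ind :: ratfun where
  "q_ind = Fract [:0, 1:] 1"

text \<open>
  Laurent polynomials in indeterminates \<open>x\<^sub>0, x\<^sub>1, \<dots>\<close>: the group algebra of the free abelian group
  of (finitely supported) exponent vectors. Any number of indeterminates is available in the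
  type; a Laurent polynomial in \<open>x\<^sub>0, \<dots>, x\<^sub>n\<close> is one in which only these occur.
\<close>

type_synonym laurent = "(nat \<Rightarrow>\<^sub>0 int) \<Rightarrow>\<^sub>0 ratfun"

definition lconst :: "ratfun \<Rightarrow> laurent" where
  "lconst c = Poly_Mapping.single 0 c"

definition xvar :: "nat \<Rightarrow> laurent" where
  "xvar i = Poly_Mapping.single (Poly_Mapping.single i 1) 1"

definition xquot :: "nat \<Rightarrow> nat \<Rightarrow> laurent" where
  "xquot i j = Poly_Mapping.single (Poly_Mapping.single i 1 - Poly_Mapping.single j 1) 1"

lemma xquot_mult_xvar: "xquot i j * xvar j = xvar i"
  by (simp add: xquot_def xvar_def mult_single)

definition CT :: "laurent \<Rightarrow> ratfun" where
  "CT p = Poly_Mapping.lookup p 0"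

definition qpoch :: "'a::comm_ring_1 \<Rightarrow> 'a \<Rightarrow> nat \<Rightarrow> 'a" where
  "qpoch q t k = (\<Prod>i<k. 1 - t * q ^ i)"

definition Lq :: "nat \<Rightarrow> (nat \<Rightarrow> nat \<Rightarrow> nat) \<Rightarrow> laurent" where
  "Lq n B = (\<Prod>(i, j) \<in> {(i, j). i < j \<and> j \<le> n}.
     qpoch (lconst q_ind) (xquot i j) (B i j) *
     qpoch (lconst q_ind) (lconst q_ind * xquot j i) (B j i))"

lemma finite_Lq_index: "finite {(i, j). i < j \<and> j \<le> (n::nat)}"
  by (rule finite_subset[of _ "{..n} \<times> {..n}"]) auto

abbreviation qfact :: "nat \<Rightarrow> ratfun" where
  "qfact k \<equiv> qpoch q_ind q_ind k"

lemma q_ind_power: "q_ind ^ k = Fract (monom 1 k) 1"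
  by (induction k) (simp_all add: q_ind_def One_fract_def monom_Suc monom_0 flip: one_pCons)

lemma one_minus_q_power_nonzero: "k > 0 \<Longrightarrow> 1 - q_ind ^ k \<noteq> 0"
proof
  assume k: "k > 0" and "1 - q_ind ^ k = 0"
  then have "q_ind ^ k = 1" by simp
  then have "(monom 1 k :: rat poly) = 1"
    by (simp add: q_ind_power One_fract_def eq_fract)
  then have "degree (monom 1 k :: rat poly) = degree (1 :: rat poly)" by simp
  with k show False by (simp add: degree_monom_eq)
qed

lemma qfact_nonzero: "qfact k \<noteq> 0"
  using one_minus_q_power_nonzero[of "Suc _"] by (simp add: qpoch_def)

end

theory Submission
  imports Defs "HOL-Library.FuncSet" "HOL-Library.Product_Lexorder"
begin

text \<open>
  Clear the denominators and interpolate in \<open>x\<^sub>1, \<dots>, x\<^sub>n\<close> on grids of powers of \<open>q\<close>, keeping \<open>x\<^sub>0 = t\<close>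
  free. This yields a polynomial \<open>g(t)\<close> of degree at most \<open>na + m\<close> whose coefficient of
  \<open>t\<^bsup>na + m\<^esup>\<close> is the constant term. Put \<open>c\<^sub>j = kj + max(0, j - n\<^sub>0)\<close>. If the product does not vanish at a
  grid point \<open>x\<^bsub>j+1\<^esub> = q\<^bsup>\<alpha> j\<^esup>\<close>, \<open>0 \<le> j < n\<close>, the exponents are spread out, and the \<open>i\<close>-th smallest one
  (counting from \<open>0\<close>) lies between \<open>c\<^sub>i\<close> and \<open>b + c\<^sub>i\<close>; hence every summand of \<open>g\<close> is divisible by the
  monic polynomial \<open>H\<close> of degree \<open>na + m\<close> with the roots \<open>q\<^bsup>c i + s\<^esup>\<close>, \<open>1 \<le> s \<le> a + \<chi>(i \<ge> n - m)\<close>. So \<open>g\<close>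
  is the constant term times \<open>H\<close>. At \<open>t = 1\<close> only the grid point \<open>\<alpha>\<^sub>j = b + c\<^sub>j\<close> contributes. After
  cancellation, the factor that \<open>x\<^bsub>j+1\<^esub>\<close> adds to its contribution is a product of ratios
  \<open>(1 - q\<^bsup>\<sigma> - c j\<^esup>) / (1 - q\<^bsup>\<sigma> - c (j+1)\<^esup>)\<close>, and these telescope in \<open>j\<close>.
\<close>

section \<open>Sums, products and polynomials\<close>

lemma (in comm_monoid_set) strict_triangle:
  "F (\<lambda>(i, j). g i j) {(i, j). i < j \<and> j \<le> (n::nat)} = F (\<lambda>j. F (\<lambda>i. g i j) {..<j}) {..n}"
  by (simp add: Sigma)
    (rule reindex_bij_witness[where i = "\<lambda>(j, i). (i, j)" and j = "\<lambda>(i, j). (j, i)"]; auto)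

lemma (in comm_monoid_set) strict_triangle_swap:
  "F (\<lambda>j. F (\<lambda>i. g i j) {..<j}) {..<n} = F (\<lambda>i. F (\<lambda>j. g i j) {Suc i..<n}) {..<n}"
  using nested_swap'[of "\<lambda>j i. g i j" "n - 1"]
  by (cases n) (simp_all flip: lessThan_Suc_atMost atLeastLessThanSuc_atLeastAtMost)

lemma prod_lessThan_add:
  fixes f :: "nat \<Rightarrow> 'a::comm_monoid_mult"
  shows "(\<Prod>i<m + r. f i) = (\<Prod>i<m. f i) * (\<Prod>s<r. f (m + s))"
  by (induction r) (simp_all add: mult.assoc)

lemma smult_sum_right: "smult c (\<Sum>i\<in>T. p i) = (\<Sum>i\<in>T. smult c (p i))"
  by (induction T rule: infinite_finite_induct) (simp_all add: smult_add_right)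

lemma poly_eqI_nonzero:
  fixes p p' :: "'a::field_char_0 poly"
  assumes "\<And>t. t \<noteq> 0 \<Longrightarrow> poly p t = poly p' t"
  shows "p = p'"
proof -
  have "poly ([:0, 1:] * p) t = poly ([:0, 1:] * p') t" for t
    using assms[of t] by (cases "t = 0") auto
  then have "poly ([:0, 1:] * p) = poly ([:0, 1:] * p')" by blast
  then show ?thesis
    unfolding poly_eq_poly_eq_iff by (metis mult_cancel_left pCons_eq_0_iff zero_neq_one)
qed

lemma prod_linear_dvd:
  fixes p :: "'a::idom poly"
  assumes "finite T" "inj_on r T" "\<And>s. s \<in> T \<Longrightarrow> poly p (r s) = 0"
  shows "(\<Prod>s\<in>T. [:- r s, 1:]) dvd p"
  using assms
proof (induction T rule: finite_induct)
  case (insert z T)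
  then have "(\<Prod>s\<in>T. [:- r s, 1:]) dvd p" by auto
  then obtain p' where p_eq: "p = (\<Prod>s\<in>T. [:- r s, 1:]) * p'" by (elim dvdE)
  have "poly (\<Prod>s\<in>T. [:- r s, 1:]) (r z) \<noteq> 0"
    using insert by (auto simp: poly_prod)
  moreover have "poly p (r z) = 0" using insert by simp
  ultimately have "[:- r z, 1:] dvd p'" by (simp add: p_eq poly_eq_0_iff_dvd)
  then have "(\<Prod>s\<in>T. [:- r s, 1:]) * [:- r z, 1:] dvd p" unfolding p_eq by (intro mult_dvd_mono) auto
  with insert show ?case by (simp add: mult.commute)
qed simp

lemma monic_dvd_imp_eq_smult:
  fixes g h :: "'a::field poly"
  assumes "h dvd g" "lead_coeff h = 1" "degree g \<le> degree h"
  shows "g = smult (coeff g (degree h)) h"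
proof -
  obtain u where g_eq: "g = h * u" using assms(1) by (elim dvdE)
  have h_nonzero: "h \<noteq> 0" using assms(2) by auto
  show ?thesis
  proof (cases "u = 0")
    case False
    then have "degree u = 0" using assms(3) h_nonzero by (simp add: g_eq degree_mult_eq)
    then obtain e where "u = [:e:]" by (elim degree_eq_zeroE)
    then have "g = smult e h" by (simp add: g_eq)
    then show ?thesis using assms(2) by simp
  qed (simp add: g_eq)
qed

section \<open>Lagrange interpolation\<close>

lemma sum_Lagrange_eq_coeff:
  fixes p :: "'a::field poly"
  assumes fin: "finite S" and deg: "degree p < card S"
  shows "(\<Sum>x\<in>S. poly p x / (\<Prod>z\<in>S - {x}. x - z)) = coeff p (card S - 1)"
proof -
  define N where "N x = (\<Prod>z\<in>S - {x}. [:- z, 1:])" for x :: 'a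
  define D where "D x = (\<Prod>z\<in>S - {x}. x - z)" for x
  define Q where "Q = (\<Sum>x\<in>S. smult (poly p x / D x) (N x))"
  have D_nonzero: "D x \<noteq> 0" for x
    using fin by (simp add: D_def)
  have degree_N: "degree (N x) = card S - 1" if "x \<in> S" for x
    using that fin by (simp add: N_def degree_prod_eq_sum_degree card_Diff_singleton)
  have monic_N: "coeff (N x) (card S - 1) = 1" if "x \<in> S" for x
    using degree_N[OF that] lead_coeff_prod[of "\<lambda>z. [:- z, 1:]" "S - {x}"] by (simp add: N_def)
  have poly_N: "poly (N x) z = (if z = x then D x else 0)" if "z \<in> S" for x z
    using that fin by (auto simp: N_def D_def poly_prod)
  have "degree Q \<le> card S - 1"
    unfolding Q_def by (intro degree_sum_le fin) (metis degree_N degree_smult_le)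
  with deg have "degree Q < card S" by linarith
  have "poly Q z = poly p z" if "z \<in> S" for z
  proof -
    have "poly Q z = (\<Sum>x\<in>S. if z = x then poly p x else 0)"
      unfolding Q_def poly_sum by (intro sum.cong) (auto simp: poly_N[OF that] D_nonzero)
    then show ?thesis using fin that by simp
  qed
  with deg \<open>degree Q < card S\<close> have "Q = p"
    by (intro poly_eqI_degree[of S]) auto
  have "coeff Q (card S - 1) = (\<Sum>x\<in>S. poly p x / D x * coeff (N x) (card S - 1))"
    by (simp add: Q_def coeff_sum)
  then show ?thesis by (simp add: \<open>Q = p\<close> D_def monic_N del: One_nat_def)
qed

definition lagrange_weight :: "nat \<Rightarrow> 'a::field set \<Rightarrow> 'a \<Rightarrow> 'a" where
  "lagrange_weight d S x = x ^ d / (\<Prod>z\<in>S - {x}. x - z)"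

lemma sum_lagrange_weight_powi:
  assumes card: "card S = Suc d" and "0 \<notin> S" and exponent: "- int d \<le> e" "e \<le> 0"
  shows "(\<Sum>x\<in>S. lagrange_weight d S x * x powi e) = of_bool (e = 0)"
proof -
  define r where "r = nat (int d + e)"
  have r_bound: "r \<le> d" "r = d \<longleftrightarrow> e = 0" using exponent by (auto simp: r_def)
  have "x ^ d * x powi e = x ^ r" if "x \<in> S" for x
  proof -
    have "x \<noteq> 0" using that \<open>0 \<notin> S\<close> by auto
    then have "x ^ d * x powi e = x powi (int d + e)" by (simp add: power_int_add)
    then show ?thesis using exponent by (simp add: r_def power_int_nonneg_exp)
  qed
  then have "(\<Sum>x\<in>S. lagrange_weight d S x * x powi e) =
      (\<Sum>x\<in>S. poly (monom 1 r) x / (\<Prod>z\<in>S - {x}. x - z))"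
    by (simp add: lagrange_weight_def poly_monom)
  also have "\<dots> = coeff (monom 1 r) (card S - 1)"
    using card r_bound card_ge_0_finite[of S]
    by (intro sum_Lagrange_eq_coeff) (simp_all add: degree_monom_eq)
  finally show ?thesis using card r_bound by auto
qed

definition grid_weight ::
  "nat \<Rightarrow> (nat \<Rightarrow> nat) \<Rightarrow> (nat \<Rightarrow> 'a::field set) \<Rightarrow> (nat \<Rightarrow> 'a) \<Rightarrow> 'a" where
  "grid_weight n d S y = (\<Prod>j<n. lagrange_weight (d j) (S j) (y j))"

section \<open>Evaluation of Laurent polynomials\<close>

lemma poly_mapping_single_add_induct [case_names zero single_add]:
  assumes "P 0" and "\<And>f a b. P f \<Longrightarrow> P (Poly_Mapping.single a b + f)"
  shows "P (f :: 'a \<Rightarrow>\<^sub>0 'b::monoid_add)"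
proof (induction f rule: update_induct)
  case (update f a b)
  then have "Poly_Mapping.update a b f = Poly_Mapping.single a b + f"
    by (intro poly_mapping_eqI) (auto simp: lookup_update lookup_add lookup_single when_def in_keys_iff)
  with update show ?case by (simp add: assms(2))
qed (rule assms(1))

definition laurent_eval :: "nat \<Rightarrow> (nat \<Rightarrow> 'a) \<Rightarrow> ((nat \<Rightarrow>\<^sub>0 int) \<Rightarrow>\<^sub>0 'a::field) \<Rightarrow> 'a" where
  "laurent_eval n x p = (\<Sum>e\<in>Poly_Mapping.keys p.
     Poly_Mapping.lookup p e * (\<Prod>i\<le>n. x i powi Poly_Mapping.lookup e i))"

lemma laurent_eval_0 [simp]: "laurent_eval n x 0 = 0"
  by (simp add: laurent_eval_def)

lemma laurent_eval_add: "laurent_eval n x (p + p') = laurent_eval n x p + laurent_eval n x p'"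
  unfolding laurent_eval_def
  by (rule setsum_keys_plus_distrib[where f = "\<lambda>e c. c * (\<Prod>i\<le>n. x i powi Poly_Mapping.lookup e i)"])
    (simp_all add: algebra_simps)

lemma laurent_eval_diff: "laurent_eval n x (p - p') = laurent_eval n x p - laurent_eval n x p'"
  using laurent_eval_add[of n x "p - p'" p'] by simp

lemma laurent_eval_single:
  "laurent_eval n x (Poly_Mapping.single e c) = c * (\<Prod>i\<le>n. x i powi Poly_Mapping.lookup e i)"
  by (simp add: laurent_eval_def)

lemma laurent_eval_1 [simp]: "laurent_eval n x 1 = 1"
  by (simp add: laurent_eval_single flip: single_one)

context
  fixes n :: nat and x :: "nat \<Rightarrow> 'a::field"
  assumes x_nonzero: "\<And>i. i \<le> n \<Longrightarrow> x i \<noteq> 0"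
begin

lemma laurent_eval_mult: "laurent_eval n x (p * p') = laurent_eval n x p * laurent_eval n x p'"
proof (induction p rule: poly_mapping_single_add_induct)
  case (single_add p e c)
  have "laurent_eval n x (Poly_Mapping.single e c * p') =
      laurent_eval n x (Poly_Mapping.single e c) * laurent_eval n x p'"
  proof (induction p' rule: poly_mapping_single_add_induct)
    case (single_add p' e' c')
    have "(\<Prod>i\<le>n. x i powi Poly_Mapping.lookup (e + e') i) =
        (\<Prod>i\<le>n. x i powi Poly_Mapping.lookup e i) * (\<Prod>i\<le>n. x i powi Poly_Mapping.lookup e' i)"
      by (simp add: lookup_add power_int_add x_nonzero flip: prod.distrib)
    with single_add show ?case
      by (simp add: laurent_eval_add laurent_eval_single distrib_left mult_single)
  qed simp
  with single_add show ?case by (simp add: laurent_eval_add distrib_right)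
qed simp

lemma laurent_eval_power: "laurent_eval n x (p ^ N) = laurent_eval n x p ^ N"
  by (induction N) (simp_all add: laurent_eval_mult)

lemma laurent_eval_prod: "laurent_eval n x (\<Prod>s\<in>T. f s) = (\<Prod>s\<in>T. laurent_eval n x (f s))"
  by (induction T rule: infinite_finite_induct) (simp_all add: laurent_eval_mult)

lemma laurent_eval_qpoch:
  "laurent_eval n x (qpoch p p' N) = qpoch (laurent_eval n x p) (laurent_eval n x p') N"
  by (simp add: qpoch_def laurent_eval_prod laurent_eval_diff laurent_eval_mult laurent_eval_power)

end

lemma laurent_eval_lconst [simp]: "laurent_eval n x (lconst c) = c"
  by (simp add: lconst_def laurent_eval_single)

lemma laurent_eval_xquot:
  assumes "i \<le> n" "j \<le> n" "i \<noteq> j"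
  shows "laurent_eval n x (xquot i j) = x i / x j"
proof -
  have "(\<Prod>l\<le>n. x l powi Poly_Mapping.lookup (Poly_Mapping.single i 1 - Poly_Mapping.single j 1) l) =
      (\<Prod>l\<le>n. (if i = l then x l else 1) * (if j = l then inverse (x l) else 1))"
    using assms(3) by (intro prod.cong) (auto simp: lookup_minus lookup_single when_def power_int_minus)
  then show ?thesis
    using assms by (simp add: xquot_def laurent_eval_single prod.distrib divide_inverse)
qed

section \<open>The constant term as a coefficient of an interpolating polynomial\<close>

definition homogeneous_pole_le :: "nat \<Rightarrow> (nat \<Rightarrow> nat) \<Rightarrow> ((nat \<Rightarrow>\<^sub>0 int) \<Rightarrow>\<^sub>0 'a::zero) \<Rightarrow> bool" where
  "homogeneous_pole_le n d p \<longleftrightarrow> (\<forall>e\<in>Poly_Mapping.keys p. (\<Sum>i\<le>n. Poly_Mapping.lookup e i) = 0 \<and>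
     (\<forall>i>n. Poly_Mapping.lookup e i = 0) \<and> (\<forall>i. - int (d i) \<le> Poly_Mapping.lookup e i))"

lemma homogeneous_pole_le_mono:
  assumes "homogeneous_pole_le n d p" "\<And>i. d i \<le> d' i"
  shows "homogeneous_pole_le n d' p"
  using assms unfolding homogeneous_pole_le_def
  by (meson le_minus_iff neg_le_iff_le of_nat_mono order_trans)

lemma homogeneous_pole_le_1: "homogeneous_pole_le n (\<lambda>_. 0) 1"
  by (simp add: homogeneous_pole_le_def)

lemma homogeneous_pole_le_mult:
  fixes p p' :: "(nat \<Rightarrow>\<^sub>0 int) \<Rightarrow>\<^sub>0 'a::semiring_0"
  assumes "homogeneous_pole_le n d p" "homogeneous_pole_le n d' p'"
  shows "homogeneous_pole_le n (\<lambda>i. d i + d' i) (p * p')"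
  unfolding homogeneous_pole_le_def
proof
  fix e assume "e \<in> Poly_Mapping.keys (p * p')"
  then obtain u u' where e_eq: "e = u + u'"
    and in_keys: "u \<in> Poly_Mapping.keys p" "u' \<in> Poly_Mapping.keys p'"
    using keys_mult[of p p'] by blast
  note exponents = assms(1)[unfolded homogeneous_pole_le_def, rule_format, OF in_keys(1)]
    assms(2)[unfolded homogeneous_pole_le_def, rule_format, OF in_keys(2)]
  have "- int (d i + d' i) \<le> Poly_Mapping.lookup e i" for i
    using exponents[THEN conjunct2, THEN conjunct2, THEN spec, of i] by (simp add: e_eq lookup_add)
  with exponents show "(\<Sum>i\<le>n. Poly_Mapping.lookup e i) = 0 \<and> (\<forall>i>n. Poly_Mapping.lookup e i = 0) \<and>
      (\<forall>i. - int (d i + d' i) \<le> Poly_Mapping.lookup e i)"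
    by (simp add: e_eq lookup_add sum.distrib)
qed

lemma homogeneous_pole_le_prod:
  fixes f :: "'b \<Rightarrow> (nat \<Rightarrow>\<^sub>0 int) \<Rightarrow>\<^sub>0 'a::comm_ring_1"
  assumes "\<And>s. s \<in> T \<Longrightarrow> homogeneous_pole_le n (d s) (f s)"
  shows "homogeneous_pole_le n (\<lambda>i. \<Sum>s\<in>T. d s i) (\<Prod>s\<in>T. f s)"
  using assms
  by (induction T rule: infinite_finite_induct)
    (simp_all add: homogeneous_pole_le_1 homogeneous_pole_le_mult)

definition x0_poly :: "nat \<Rightarrow> nat \<Rightarrow> (nat \<Rightarrow> 'a) \<Rightarrow> ((nat \<Rightarrow>\<^sub>0 int) \<Rightarrow>\<^sub>0 'a::field) \<Rightarrow> 'a poly" where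
  "x0_poly n N y p = (\<Sum>e\<in>Poly_Mapping.keys p.
     monom (Poly_Mapping.lookup p e * (\<Prod>j<n. y j powi Poly_Mapping.lookup e (Suc j)))
       (nat (int N + Poly_Mapping.lookup e 0)))"

lemma poly_x0_poly:
  assumes "homogeneous_pole_le n d p" "t \<noteq> 0"
  shows "poly (x0_poly n (d 0) y p) t = t ^ d 0 * laurent_eval n (case_nat t y) p"
proof -
  have "t ^ nat (int (d 0) + Poly_Mapping.lookup e 0) = t ^ d 0 * t powi Poly_Mapping.lookup e 0"
    if "e \<in> Poly_Mapping.keys p" for e
  proof -
    have "- int (d 0) \<le> Poly_Mapping.lookup e 0"
      using assms(1) that unfolding homogeneous_pole_le_def by blast
    then have "t ^ nat (int (d 0) + Poly_Mapping.lookup e 0) =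
        t powi (int (d 0) + Poly_Mapping.lookup e 0)"
      by (simp add: power_int_nonneg_exp)
    then show ?thesis using \<open>t \<noteq> 0\<close> by (simp add: power_int_add)
  qed
  then show ?thesis
    by (simp add: x0_poly_def laurent_eval_def poly_sum poly_monom sum_distrib_left mult_ac
        prod.lessThan_Suc_shift del: prod.lessThan_Suc flip: lessThan_Suc_atMost)
qed

context
  fixes n :: nat and d :: "nat \<Rightarrow> nat" and S :: "nat \<Rightarrow> 'a::field set"
    and p :: "(nat \<Rightarrow>\<^sub>0 int) \<Rightarrow>\<^sub>0 'a"
  assumes homogeneous: "homogeneous_pole_le n d p"
    and card_S: "\<And>j. j < n \<Longrightarrow> card (S j) = Suc (d (Suc j))"
    and S_nonzero: "\<And>j. j < n \<Longrightarrow> 0 \<notin> S j"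
begin

definition moment :: "(nat \<Rightarrow>\<^sub>0 int) \<Rightarrow> 'a" where
  "moment e = (\<Prod>j<n. \<Sum>x\<in>S j.
     lagrange_weight (d (Suc j)) (S j) x * x powi Poly_Mapping.lookup e (Suc j))"

lemma moment_0: "moment 0 = 1"
  using sum_lagrange_weight_powi[OF card_S S_nonzero, of _ 0] by (simp add: moment_def)

lemma moment_eq_0:
  assumes "e \<in> Poly_Mapping.keys p" "0 \<le> Poly_Mapping.lookup e 0" "e \<noteq> 0"
  shows "moment e = 0"
proof -
  note exponents = homogeneous[unfolded homogeneous_pole_le_def, rule_format, OF assms(1)]
  have "\<exists>j<n. Poly_Mapping.lookup e (Suc j) < 0"
  proof (rule ccontr)
    assume "\<not> ?thesis"
    then have "0 \<le> Poly_Mapping.lookup e i" if "i \<le> n" for i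
      using that assms(2) by (cases i) (fastforce simp: not_less Suc_le_eq)+
    then have "\<forall>i\<le>n. Poly_Mapping.lookup e i = 0"
      using exponents by (subst (asm) sum_nonneg_eq_0_iff) auto
    with exponents have "Poly_Mapping.lookup e i = 0" for i
      by (cases "i \<le> n") auto
    with assms(3) show False by (auto intro: poly_mapping_eqI)
  qed
  then obtain j where "j < n" "Poly_Mapping.lookup e (Suc j) < 0" by blast
  then have "(\<Sum>x\<in>S j. lagrange_weight (d (Suc j)) (S j) x * x powi Poly_Mapping.lookup e (Suc j)) = 0"
    using exponents card_S S_nonzero by (subst sum_lagrange_weight_powi) auto
  with \<open>j < n\<close> show ?thesis unfolding moment_def by (intro prod_zero) auto
qed

lemma sum_grid_weight_x0_poly:
  "(\<Sum>y\<in>PiE {..<n} S. smult (grid_weight n (\<lambda>j. d (Suc j)) S y) (x0_poly n (d 0) y p)) =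
   (\<Sum>e\<in>Poly_Mapping.keys p.
      monom (Poly_Mapping.lookup p e * moment e) (nat (int (d 0) + Poly_Mapping.lookup e 0)))"
proof -
  have "finite (S j)" if "j < n" for j
    using card_S[OF that] by (intro card_ge_0_finite) simp
  then have "moment e = (\<Sum>y\<in>PiE {..<n} S. grid_weight n (\<lambda>j. d (Suc j)) S y *
      (\<Prod>j<n. y j powi Poly_Mapping.lookup e (Suc j)))" for e
    unfolding moment_def grid_weight_def prod.distrib[symmetric] by (intro prod_sum_PiE) auto
  then show ?thesis
    unfolding x0_poly_def smult_sum_right
    by (subst sum.swap) (simp add: smult_monom sum_distrib_left monom_sum mult.left_commute)
qed

lemma degree_sum_grid_weight_x0_poly_le:
  "degree (\<Sum>y\<in>PiE {..<n} S. smult (grid_weight n (\<lambda>j. d (Suc j)) S y) (x0_poly n (d 0) y p)) \<le> d 0"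
  unfolding sum_grid_weight_x0_poly
proof (intro degree_sum_le finite_keys)
  fix e assume in_keys: "e \<in> Poly_Mapping.keys p"
  show "degree (monom (Poly_Mapping.lookup p e * moment e)
      (nat (int (d 0) + Poly_Mapping.lookup e 0))) \<le> d 0"
  proof (cases "Poly_Mapping.lookup e 0 \<le> 0")
    case True
    then show ?thesis by (intro order.trans[OF degree_monom_le]) auto
  next
    case False
    then show ?thesis using in_keys by (subst moment_eq_0) auto
  qed
qed

lemma coeff_sum_grid_weight_x0_poly:
  "coeff (\<Sum>y\<in>PiE {..<n} S. smult (grid_weight n (\<lambda>j. d (Suc j)) S y) (x0_poly n (d 0) y p)) (d 0) =
   Poly_Mapping.lookup p 0"
proof -
  have "coeff (monom (Poly_Mapping.lookup p e * moment e)
        (nat (int (d 0) + Poly_Mapping.lookup e 0))) (d 0) =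
      (if e = 0 then Poly_Mapping.lookup p e else 0)" if in_keys: "e \<in> Poly_Mapping.keys p" for e
  proof (cases "e = 0")
    case True
    then show ?thesis by (simp add: moment_0)
  next
    case False
    moreover have "- int (d 0) \<le> Poly_Mapping.lookup e 0"
      using homogeneous in_keys unfolding homogeneous_pole_le_def by blast
    ultimately show ?thesis
      using moment_eq_0[OF in_keys] by (cases "0 \<le> Poly_Mapping.lookup e 0") auto
  qed
  then show ?thesis
    unfolding sum_grid_weight_x0_poly by (simp add: coeff_sum in_keys_iff)
qed

end

section \<open>The Laurent polynomial as a function of \<open>x\<^sub>0\<close>\<close>

lemma homogeneous_pole_le_qpoch_xquot:
  assumes "i \<le> n" "j \<le> n" "i \<noteq> j"
  shows "homogeneous_pole_le n (\<lambda>l. of_bool (l = j) * r) (qpoch (lconst c) (lconst c' * xquot i j) r)"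
proof -
  define u :: "nat \<Rightarrow>\<^sub>0 int" where "u = Poly_Mapping.single i 1 - Poly_Mapping.single j 1"
  have lookup_u: "Poly_Mapping.lookup u l = of_bool (l = i) - of_bool (l = j)" for l
    by (auto simp: u_def lookup_minus lookup_single when_def)
  have sum_u: "(\<Sum>l\<le>n. Poly_Mapping.lookup u l) = 0"
    using assms by (simp add: lookup_u sum_subtractf of_bool_def)
  have lconst_power: "lconst c ^ s = lconst (c ^ s)" for s
    by (induction s) (simp_all add: lconst_def mult_single)
  have "homogeneous_pole_le n (\<lambda>l. of_bool (l = j)) (1 - lconst c' * xquot i j * lconst c ^ s)" for s
  proof -
    have "lconst c' * xquot i j * lconst c ^ s = Poly_Mapping.single u (c' * c ^ s)"
      unfolding lconst_power by (simp add: lconst_def xquot_def mult_single u_def)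
    then have "Poly_Mapping.keys (1 - lconst c' * xquot i j * lconst c ^ s) \<subseteq> {0, u}"
      using keys_diff[of 1 "Poly_Mapping.single u (c' * c ^ s)"] by (auto split: if_splits)
    then show ?thesis
      using assms sum_u by (auto simp: homogeneous_pole_le_def lookup_u)
  qed
  from homogeneous_pole_le_prod[of "{..<r}" n "\<lambda>_ l. of_bool (l = j)", OF this] show ?thesis
    by (simp add: qpoch_def mult.commute)
qed

lemma homogeneous_pole_le_Lq: "homogeneous_pole_le n (\<lambda>l. \<Sum>i\<le>n. B i l) (Lq n B)"
proof -
  have "lconst 1 = 1" by (simp add: lconst_def)
  then have "homogeneous_pole_le n (\<lambda>l. of_bool (l = j) * B i j + of_bool (l = i) * B j i)
      (qpoch (lconst q_ind) (xquot i j) (B i j) *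
       qpoch (lconst q_ind) (lconst q_ind * xquot j i) (B j i))"
    if "i < j" "j \<le> n" for i j
    using that homogeneous_pole_le_qpoch_xquot[of i n j "B i j" q_ind 1]
    by (intro homogeneous_pole_le_mult homogeneous_pole_le_qpoch_xquot) auto
  then have "homogeneous_pole_le n (\<lambda>l. \<Sum>(i, j)\<in>{(i, j). i < j \<and> j \<le> n}.
      of_bool (l = j) * B i j + of_bool (l = i) * B j i) (Lq n B)"
    unfolding Lq_def
    by (subst case_prod_unfold, subst case_prod_unfold, intro homogeneous_pole_le_prod) auto
  moreover have "(\<Sum>(i, j)\<in>{(i, j). i < j \<and> j \<le> n}.
      of_bool (l = j) * B i j + of_bool (l = i) * B j i) \<le> (\<Sum>i\<le>n. B i l)" for l
  proof -
    have "(\<Sum>i<j. of_bool (l = j) * B i j + of_bool (l = i) * B j i) =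
        (if j = l then \<Sum>i<l. B i l else 0) + (if l < j then B j l else 0)" for j
      by (simp add: sum.distrib of_bool_def if_distrib[of "\<lambda>x. x * _"] cong: if_cong)
    then have "(\<Sum>(i, j)\<in>{(i, j). i < j \<and> j \<le> n}. of_bool (l = j) * B i j + of_bool (l = i) * B j i) =
        (if l \<le> n then \<Sum>i<l. B i l else 0) + (\<Sum>j\<in>{..n} \<inter> {l<..}. B j l)"
      by (simp add: sum.strict_triangle sum.distrib sum.If_cases greaterThan_def)
    also have "\<dots> = (\<Sum>i\<in>(if l \<le> n then {..<l} else {}) \<union> ({..n} \<inter> {l<..}). B i l)"
      by (subst sum.union_disjoint) auto
    also have "\<dots> \<le> (\<Sum>i\<le>n. B i l)"
      by (rule sum_mono2) (auto split: if_splits)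
    finally show ?thesis .
  qed
  ultimately show ?thesis by (rule homogeneous_pole_le_mono)
qed

lemma laurent_eval_Lq:
  assumes "t \<noteq> 0" "\<And>j. j < n \<Longrightarrow> y j \<noteq> 0"
  shows "laurent_eval n (case_nat t y) (Lq n B) =
    (\<Prod>j<n. qpoch q_ind (t / y j) (B 0 (Suc j)) * qpoch q_ind (q_ind * (y j / t)) (B (Suc j) 0)) *
    (\<Prod>j<n. \<Prod>i<j. qpoch q_ind (y i / y j) (B (Suc i) (Suc j)) *
       qpoch q_ind (q_ind * (y j / y i)) (B (Suc j) (Suc i)))"
proof -
  define x where "x = case_nat t y"
  have x_simps: "x 0 = t" "x (Suc j) = y j" for j by (simp_all add: x_def)
  have x_nonzero: "x i \<noteq> 0" if "i \<le> n" for i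
    using that assms by (cases i) (auto simp: x_simps)
  have "laurent_eval n x (Lq n B) = (\<Prod>(i, j) \<in> {(i, j). i < j \<and> j \<le> n}.
      qpoch q_ind (x i / x j) (B i j) * qpoch q_ind (q_ind * (x j / x i)) (B j i))"
    unfolding Lq_def using x_nonzero
    by (subst laurent_eval_prod)
      (auto intro!: prod.cong simp: laurent_eval_mult laurent_eval_qpoch laurent_eval_xquot)
  also have "\<dots> = (\<Prod>j<n. \<Prod>i<Suc j. qpoch q_ind (x i / x (Suc j)) (B i (Suc j)) *
      qpoch q_ind (q_ind * (x (Suc j) / x i)) (B (Suc j) i))"
    unfolding prod.strict_triangle lessThan_Suc_atMost[symmetric] prod.lessThan_Suc_shift[of _ n]
    by simp
  finally show ?thesis
    unfolding prod.lessThan_Suc_shift prod.distrib x_simps by (simp add: x_def mult_ac)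
qed

definition cross :: "'a::field \<Rightarrow> nat \<Rightarrow> (nat \<Rightarrow> nat) \<Rightarrow> (nat \<Rightarrow> 'a) \<Rightarrow> 'a" where
  "cross q n \<beta> y = (\<Prod>j<n. \<Prod>i<j. qpoch q (y i / y j) (\<beta> i) * qpoch q (q * (y j / y i)) (\<beta> i))"

lemma cross_restrict: "cross q n \<beta> (restrict y {..<n}) = cross q n \<beta> y"
  unfolding cross_def by (intro prod.cong refl) auto

definition x0_factor :: "'a::field \<Rightarrow> nat \<Rightarrow> nat \<Rightarrow> 'a \<Rightarrow> 'a poly" where
  "x0_factor q b A x = (\<Prod>s<b. [:1, - (q ^ s / x):]) * (\<Prod>s<A. [:- (q ^ Suc s * x), 1:])"

lemma power_mult_qpoch:
  fixes x :: "'a::field"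
  assumes "x \<noteq> 0"
  shows "x ^ r * qpoch q (y / x) r = (\<Prod>s<r. x - q ^ s * y)"
proof -
  have "x ^ r * qpoch q (y / x) r = (\<Prod>s<r. x * (1 - y / x * q ^ s))"
    by (simp add: qpoch_def prod.distrib)
  also have "\<dots> = (\<Prod>s<r. x - q ^ s * y)"
    using assms by (intro prod.cong) (auto simp: field_simps)
  finally show ?thesis .
qed

lemma power_mult_qpoch_q:
  fixes x :: "'a::field"
  assumes "x \<noteq> 0"
  shows "x ^ r * qpoch q (q * (y / x)) r = (\<Prod>s<r. x - q ^ Suc s * y)"
  using power_mult_qpoch[OF assms, of r q "q * y"] by (simp add: mult_ac)

lemma poly_x0_factor:
  assumes "t \<noteq> 0"
  shows "poly (x0_factor q b A x) t = t ^ A * (qpoch q (t / x) b * qpoch q (q * (x / t)) A)"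
proof -
  have "poly (x0_factor q b A x) t = qpoch q (t / x) b * (\<Prod>s<A. t - q ^ Suc s * x)"
    by (simp add: x0_factor_def poly_prod qpoch_def mult_ac)
  also have "(\<Prod>s<A. t - q ^ Suc s * x) = t ^ A * qpoch q (q * (x / t)) A"
    by (rule power_mult_qpoch_q[OF assms, symmetric])
  finally show ?thesis by (simp only: mult_ac)
qed

definition pole_order :: "nat \<Rightarrow> nat \<Rightarrow> (nat \<Rightarrow> nat) \<Rightarrow> nat \<Rightarrow> nat" where
  "pole_order n b \<beta> j = b + (\<Sum>i<j. \<beta> i) + (n - 1 - j) * \<beta> j"

lemma clear_denominators:
  fixes q :: "'a::field"
  assumes y_nonzero: "\<And>j. j < n \<Longrightarrow> y j \<noteq> 0"
  shows "(\<Prod>j<n. y j ^ pole_order n b \<beta> j) * (\<Prod>j<n. qpoch q (1 / y j) b) * cross q n \<beta> y =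
    (\<Prod>j<n. (\<Prod>s<b. y j - q ^ s) * (\<Prod>i<j. \<Prod>s<\<beta> i. y j - q ^ s * y i) *
       (\<Prod>l=Suc j..<n. \<Prod>s<\<beta> j. y j - q ^ Suc s * y l))"
proof -
  have "y j ^ pole_order n b \<beta> j = y j ^ b * (\<Prod>i<j. y j ^ \<beta> i) * (\<Prod>l=Suc j..<n. y j ^ \<beta> j)" for j
    by (simp add: pole_order_def power_add power_sum flip: power_mult) (simp add: mult.commute)
  then have "(\<Prod>j<n. y j ^ pole_order n b \<beta> j) * (\<Prod>j<n. qpoch q (1 / y j) b) * cross q n \<beta> y =
    (\<Prod>j<n. y j ^ b * qpoch q (1 / y j) b) *
      (\<Prod>j<n. \<Prod>i<j. (y j ^ \<beta> i * qpoch q (y i / y j) (\<beta> i)) *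
         (y i ^ \<beta> i * qpoch q (q * (y j / y i)) (\<beta> i)))"
    unfolding cross_def by (simp only: prod.distrib prod.strict_triangle_swap[symmetric] mult_ac)
  also have "\<dots> = (\<Prod>j<n. \<Prod>s<b. y j - q ^ s) *
      (\<Prod>j<n. \<Prod>i<j. (\<Prod>s<\<beta> i. y j - q ^ s * y i) * (\<Prod>s<\<beta> i. y i - q ^ Suc s * y j))"
    using y_nonzero
    by (intro arg_cong2[of _ _ _ _ "(*)"] prod.cong refl)
      (auto simp: power_mult_qpoch power_mult_qpoch_q simp del: power_Suc times_divide_eq_right)
  finally show ?thesis by (simp only: prod.distrib prod.strict_triangle_swap mult_ac)
qed

definition interpolant ::
  "'a::field \<Rightarrow> nat \<Rightarrow> nat \<Rightarrow> (nat \<Rightarrow> nat) \<Rightarrow> (nat \<Rightarrow> nat) \<Rightarrow> (nat \<Rightarrow> 'a set) \<Rightarrow> 'a poly" where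
  "interpolant q n b A \<beta> S = (\<Sum>y\<in>PiE {..<n} S.
     smult (grid_weight n (pole_order n b \<beta>) S y * cross q n \<beta> y) (\<Prod>j<n. x0_factor q b (A j) (y j)))"

locale exponent_matrix =
  fixes n b :: nat and A \<beta> :: "nat \<Rightarrow> nat" and B :: "nat \<Rightarrow> nat \<Rightarrow> nat"
  assumes diagonal: "i \<le> n \<Longrightarrow> B i i = 0"
    and row_0: "j < n \<Longrightarrow> B 0 (Suc j) = b"
    and column_0: "j < n \<Longrightarrow> B (Suc j) 0 = A j"
    and above_diagonal: "i < j \<Longrightarrow> j < n \<Longrightarrow> B (Suc i) (Suc j) = \<beta> i"
    and below_diagonal: "i < j \<Longrightarrow> j < n \<Longrightarrow> B (Suc j) (Suc i) = \<beta> i"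
begin

lemma column_sum_0: "(\<Sum>i\<le>n. B i 0) = (\<Sum>j<n. A j)"
  by (simp add: sum.lessThan_Suc_shift diagonal column_0 del: sum.lessThan_Suc
      flip: lessThan_Suc_atMost)

lemma column_sum_Suc:
  assumes "j < n"
  shows "(\<Sum>i\<le>n. B i (Suc j)) = pole_order n b \<beta> j"
proof -
  have "(\<Sum>i<n. B (Suc i) (Suc j)) = (\<Sum>i<j. B (Suc i) (Suc j)) + (\<Sum>i=j..<n. B (Suc i) (Suc j))"
    using assms sum.atLeastLessThan_concat[of 0 j n "\<lambda>i. B (Suc i) (Suc j)"]
    by (simp add: atLeast0LessThan)
  also have "\<dots> = (\<Sum>i<j. \<beta> i) + (\<Sum>i=Suc j..<n. \<beta> j)"
    unfolding sum.atLeast_Suc_lessThan[OF assms]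
    using assms by (simp add: diagonal above_diagonal below_diagonal)
  finally show ?thesis
    using assms
    by (simp add: pole_order_def sum.lessThan_Suc_shift row_0 del: sum.lessThan_Suc
        flip: lessThan_Suc_atMost)
qed

lemma x0_poly_Lq:
  assumes y_nonzero: "\<And>j. j < n \<Longrightarrow> y j \<noteq> 0"
  shows "x0_poly n (\<Sum>j<n. A j) y (Lq n B) =
    smult (cross q_ind n \<beta> y) (\<Prod>j<n. x0_factor q_ind b (A j) (y j))"
proof (rule poly_eqI_nonzero)
  fix t :: ratfun assume t_nonzero: "t \<noteq> 0"
  have "laurent_eval n (case_nat t y) (Lq n B) =
      (\<Prod>j<n. qpoch q_ind (t / y j) b * qpoch q_ind (q_ind * (y j / t)) (A j)) * cross q_ind n \<beta> y"
    using t_nonzero y_nonzero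
    by (simp add: laurent_eval_Lq cross_def row_0 column_0 above_diagonal below_diagonal
        del: times_divide_eq_right)
  then show "poly (x0_poly n (\<Sum>j<n. A j) y (Lq n B)) t =
      poly (smult (cross q_ind n \<beta> y) (\<Prod>j<n. x0_factor q_ind b (A j) (y j))) t"
    using poly_x0_poly[OF homogeneous_pole_le_Lq[of n B] t_nonzero, of y] t_nonzero
    by (simp add: column_sum_0 poly_prod poly_x0_factor power_sum prod.distrib mult_ac
        del: times_divide_eq_right)
qed

context
  fixes S :: "nat \<Rightarrow> ratfun set"
  assumes card_S: "\<And>j. j < n \<Longrightarrow> card (S j) = Suc (pole_order n b \<beta> j)"
    and S_nonzero: "\<And>j. j < n \<Longrightarrow> 0 \<notin> S j"
begin

lemma interpolant_eq_sum_grid_weight: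
  "interpolant q_ind n b A \<beta> S = (\<Sum>y\<in>PiE {..<n} S.
     smult (grid_weight n (\<lambda>j. \<Sum>i\<le>n. B i (Suc j)) S y) (x0_poly n (\<Sum>i\<le>n. B i 0) y (Lq n B)))"
  unfolding interpolant_def
proof (rule sum.cong[OF refl])
  fix y assume y_in_grid: "y \<in> PiE {..<n} S"
  have "y j \<noteq> 0" if "j < n" for j
    using PiE_mem[OF y_in_grid, of j] S_nonzero[OF that] that by (metis lessThan_iff)
  then have "x0_poly n (\<Sum>i\<le>n. B i 0) y (Lq n B) =
      smult (cross q_ind n \<beta> y) (\<Prod>j<n. x0_factor q_ind b (A j) (y j))"
    unfolding column_sum_0 by (rule x0_poly_Lq)
  then show "smult (grid_weight n (pole_order n b \<beta>) S y * cross q_ind n \<beta> y)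
      (\<Prod>j<n. x0_factor q_ind b (A j) (y j)) =
    smult (grid_weight n (\<lambda>j. \<Sum>i\<le>n. B i (Suc j)) S y) (x0_poly n (\<Sum>i\<le>n. B i 0) y (Lq n B))"
    by (simp add: grid_weight_def column_sum_Suc)
qed

lemma card_S_eq_column_sum: "j < n \<Longrightarrow> card (S j) = Suc (\<Sum>i\<le>n. B i (Suc j))"
  by (simp add: card_S column_sum_Suc)

lemma degree_interpolant_le: "degree (interpolant q_ind n b A \<beta> S) \<le> (\<Sum>j<n. A j)"
  unfolding interpolant_eq_sum_grid_weight column_sum_0[symmetric]
  using homogeneous_pole_le_Lq card_S_eq_column_sum S_nonzero
  by (rule degree_sum_grid_weight_x0_poly_le[where d = "\<lambda>l. \<Sum>i\<le>n. B i l"])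

lemma coeff_interpolant_eq_CT: "coeff (interpolant q_ind n b A \<beta> S) (\<Sum>j<n. A j) = CT (Lq n B)"
  unfolding interpolant_eq_sum_grid_weight column_sum_0[symmetric] CT_def
  using homogeneous_pole_le_Lq card_S_eq_column_sum S_nonzero
  by (rule coeff_sum_grid_weight_x0_poly[where d = "\<lambda>l. \<Sum>i\<le>n. B i l"])

end

end

section \<open>Spread exponent vectors\<close>

definition spread :: "nat \<Rightarrow> (nat \<Rightarrow> nat) \<Rightarrow> (nat \<Rightarrow> nat) \<Rightarrow> bool" where
  "spread n \<beta> \<alpha> \<longleftrightarrow> (\<forall>i j. i < j \<longrightarrow> j < n \<longrightarrow>
     (if \<alpha> i \<le> \<alpha> j then \<alpha> i + \<beta> i \<le> \<alpha> j else \<alpha> j + \<beta> i < \<alpha> i))"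

definition gap :: "nat \<Rightarrow> nat \<Rightarrow> nat \<Rightarrow> nat" where
  "gap n0 k j = k + of_bool (n0 \<le> j)"

definition ladder :: "nat \<Rightarrow> nat \<Rightarrow> nat \<Rightarrow> nat" where
  "ladder n0 k i = (\<Sum>l<i. gap n0 k l)"

lemma ladder_0 [simp]: "ladder n0 k 0 = 0"
  by (simp add: ladder_def)

lemma ladder_Suc: "ladder n0 k (Suc i) = ladder n0 k i + gap n0 k i"
  by (simp add: ladder_def)

lemma ladder_eq: "ladder n0 k i = k * i + (i - n0)"
  by (induction i) (auto simp: ladder_Suc gap_def)

lemma ladder_mono: "i \<le> j \<Longrightarrow> ladder n0 k i \<le> ladder n0 k j"
  by (auto simp: ladder_eq intro!: add_mono)

lemma ladder_strict_mono: "i < j \<Longrightarrow> n0 < j \<Longrightarrow> ladder n0 k i < ladder n0 k j"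
  unfolding ladder_eq by (rule add_le_less_mono) auto

text \<open>
  For \<open>j < n\<^sub>0\<close> the removed points bring the grid down to the size dictated by the exponent of \<open>x\<^bsub>j+1\<^esub>\<close>
  that is to be extracted; they are chosen such that \<open>grid_le_ladder\<close> holds.
\<close>

definition levels :: "nat \<Rightarrow> nat \<Rightarrow> nat \<Rightarrow> nat \<Rightarrow> nat set" where
  "levels n n0 k j =
     {ladder n0 k (Suc j)<..ladder n0 k n} - (if j < n0 then ladder n0 k ` {n0<..n} else {})"

definition grid :: "nat \<Rightarrow> nat \<Rightarrow> nat \<Rightarrow> nat \<Rightarrow> nat \<Rightarrow> nat set" where
  "grid n n0 k b j = {..b + ladder n0 k j} \<union> (\<lambda>\<sigma>. b + \<sigma> - gap n0 k j) ` levels n n0 k j"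

lemma grid_le_ladder_n:
  assumes "\<gamma> \<in> grid n n0 k b j" "j < n"
  shows "\<gamma> + gap n0 k j \<le> b + ladder n0 k n"
  using assms ladder_mono[of "Suc j" n n0 k] by (auto simp: grid_def levels_def ladder_Suc)

lemma grid_le_ladder:
  assumes in_grid: "\<gamma> \<in> grid n n0 k b j" and "i < n"
    and gap_fits: "\<gamma> + gap n0 k j \<le> b + ladder n0 k (Suc i)"
  shows "\<gamma> \<le> b + ladder n0 k i"
proof (cases "i < n0 \<or> n0 \<le> j")
  case True
  with gap_fits show ?thesis by (cases "n0 \<le> i") (auto simp: ladder_Suc gap_def)
next
  case False
  then have "j < n0" "n0 \<le> i" by auto
  from in_grid consider (below) "\<gamma> \<le> b + ladder n0 k j"
    | (level) \<sigma> where "\<gamma> = b + \<sigma> - gap n0 k j" "\<sigma> \<in> levels n n0 k j"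
    by (auto simp: grid_def)
  then show ?thesis
  proof cases
    case below
    with ladder_mono[of j i n0 k] \<open>j < n0\<close> \<open>n0 \<le> i\<close> show ?thesis by linarith
  next
    case level
    then have "gap n0 k j \<le> \<sigma>" "\<sigma> \<noteq> ladder n0 k (Suc i)"
      using \<open>j < n0\<close> \<open>n0 \<le> i\<close> \<open>i < n\<close> by (auto simp: levels_def ladder_Suc[of _ _ j])
    with level gap_fits \<open>j < n0\<close> \<open>n0 \<le> i\<close> show ?thesis by (auto simp: ladder_Suc gap_def)
  qed
qed

lemma ex_lex_sorting:
  fixes \<alpha> :: "nat \<Rightarrow> nat"
  obtains \<pi> where "bij_betw \<pi> {..<n} {..<n}"
    "\<And>i. Suc i < n \<Longrightarrow> (\<alpha> (\<pi> i), \<pi> i) < (\<alpha> (\<pi> (Suc i)), \<pi> (Suc i))"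
proof -
  define ps where "ps = sorted_list_of_set ((\<lambda>j. (\<alpha> j, j)) ` {..<n})"
  have length: "length ps = n"
    using card_image[of "\<lambda>j. (\<alpha> j, j)" "{..<n}"] by (simp add: ps_def inj_on_def)
  have set: "set ps = (\<lambda>j. (\<alpha> j, j)) ` {..<n}" by (simp add: ps_def)
  define \<pi> where "\<pi> i = snd (ps ! i)" for i
  have nth: "ps ! i = (\<alpha> (\<pi> i), \<pi> i)" if "i < n" for i
    using that nth_mem[of i ps] by (auto simp: length set \<pi>_def)
  show thesis
  proof
    have "distinct ps" by (simp add: ps_def)
    then have "bij_betw ((!) ps) {..<n} (set ps)"
      by (rule bij_betw_nth) (simp_all add: length)
    moreover have "bij_betw snd (set ps) {..<n}"
      by (auto simp: set bij_betw_def inj_on_def image_image)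
    ultimately show "bij_betw \<pi> {..<n} {..<n}"
      unfolding \<pi>_def[abs_def] using bij_betw_trans[of "(!) ps" "{..<n}" "set ps" snd "{..<n}"]
      by (simp add: comp_def)
    fix i assume "Suc i < n"
    moreover have "sorted_wrt (<) ps" by (simp add: ps_def)
    ultimately have "ps ! i < ps ! Suc i"
      using sorted_wrt_nth_less[of "(<)" ps i "Suc i"] by (simp add: length)
    with \<open>Suc i < n\<close> show "(\<alpha> (\<pi> i), \<pi> i) < (\<alpha> (\<pi> (Suc i)), \<pi> (Suc i))"
      by (simp add: nth)
  qed
qed

lemma increasing_bij_betw_lessThan_eq:
  fixes \<pi> :: "nat \<Rightarrow> nat"
  assumes bij: "bij_betw \<pi> {..<n} {..<n}" and increasing: "\<And>i. Suc i < n \<Longrightarrow> \<pi> i < \<pi> (Suc i)" and "i < n"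
  shows "\<pi> i = i"
proof -
  have "sorted_wrt (<) (map \<pi> [0..<n])"
    by (subst sorted_wrt_iff_nth_Suc_transp) (auto simp: transp_def increasing)
  moreover have "set (map \<pi> [0..<n]) = set [0..<n]"
    using bij by (simp add: bij_betw_def atLeast0LessThan)
  ultimately have "map \<pi> [0..<n] = [0..<n]" by (intro strict_sorted_equal) auto
  with \<open>i < n\<close> show ?thesis by (metis add_0 diff_zero length_upt nth_map nth_upt)
qed

locale sorted_spread =
  fixes n n0 k :: nat and \<alpha> \<pi> :: "nat \<Rightarrow> nat"
  assumes spread: "spread n (gap n0 k) \<alpha>"
    and bij: "bij_betw \<pi> {..<n} {..<n}"
    and lex_sorted: "Suc i < n \<Longrightarrow> (\<alpha> (\<pi> i), \<pi> i) < (\<alpha> (\<pi> (Suc i)), \<pi> (Suc i))"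
begin

lemma sorting_less: "i < n \<Longrightarrow> \<pi> i < n"
  using bij by (auto simp: bij_betw_def)

lemma gap_le_at_ascent:
  assumes "Suc i < n" "\<pi> i < \<pi> (Suc i)"
  shows "\<alpha> (\<pi> i) + gap n0 k (\<pi> i) \<le> \<alpha> (\<pi> (Suc i))"
  using spread[unfolded spread_def, rule_format, of "\<pi> i" "\<pi> (Suc i)"] assms
    lex_sorted[of i] sorting_less[of "Suc i"] by auto

lemma gap_less_at_descent:
  assumes "Suc i < n" "\<not> \<pi> i < \<pi> (Suc i)"
  shows "\<alpha> (\<pi> i) + gap n0 k (\<pi> (Suc i)) < \<alpha> (\<pi> (Suc i))"
proof -
  have "\<pi> (Suc i) \<noteq> \<pi> i"
    using inj_onD[OF bij_betw_imp_inj_on[OF bij], of i "Suc i"] assms by auto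
  then show ?thesis
    using spread[unfolded spread_def, rule_format, of "\<pi> (Suc i)" "\<pi> i"] assms
      lex_sorted[of i] sorting_less[of i] by auto
qed

lemma gap_le:
  assumes "Suc i < n"
  shows "\<alpha> (\<pi> i) + gap n0 k (\<pi> i) \<le> \<alpha> (\<pi> (Suc i))"
  using gap_le_at_ascent[OF assms] gap_less_at_descent[OF assms]
  by (cases "\<pi> i < \<pi> (Suc i)") (auto simp: gap_def)

text \<open>
  Only at a tight step can the exponent grow by as little as \<open>k\<close>, and at most \<open>n\<^sub>0\<close> steps are tight.
\<close>

definition tight :: "nat \<Rightarrow> bool" where
  "tight i \<longleftrightarrow> \<pi> i < n0 \<and> \<pi> i < \<pi> (Suc i)"

lemma step_le:
  assumes "Suc i < n"
  shows "\<alpha> (\<pi> i) + k + of_bool (\<not> tight i) \<le> \<alpha> (\<pi> (Suc i))"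
  using gap_le_at_ascent[OF assms] gap_less_at_descent[OF assms]
  by (cases "\<pi> i < \<pi> (Suc i)") (auto simp: gap_def tight_def)

lemma card_positions_le:
  assumes "T \<subseteq> {..<n}" "\<And>l. l \<in> T \<Longrightarrow> \<pi> l < n0"
  shows "card T \<le> n0"
  using card_inj_on_le[of \<pi> T "{..<n0}"] assms inj_on_subset[OF bij_betw_imp_inj_on[OF bij]] by auto

context
  fixes lo :: nat
  assumes lo_le: "\<And>j. j < n \<Longrightarrow> lo \<le> \<alpha> j"
begin

lemma step_count_le:
  assumes "i < n"
  shows "lo + k * i + card {l. l < i \<and> \<not> tight l} \<le> \<alpha> (\<pi> i)"
  using assms
proof (induction i)
  case 0
  then show ?case using lo_le sorting_less by simp
next
  case (Suc i)
  have "{l. l < Suc i \<and> \<not> tight l} = {l. l < i \<and> \<not> tight l} \<union> (if tight i then {} else {i})"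
    by (auto simp: less_Suc_eq)
  then have "card {l. l < Suc i \<and> \<not> tight l} = card {l. l < i \<and> \<not> tight l} + of_bool (\<not> tight i)"
    by auto
  with step_le[of i] Suc show ?case by simp
qed

lemma card_not_tight: "card {l. l < i \<and> \<not> tight l} = i - card {l. l < i \<and> tight l}"
proof -
  have "{l. l < i \<and> \<not> tight l} = {..<i} - {l. l < i \<and> tight l}" by auto
  moreover have "{l. l < i \<and> tight l} \<subseteq> {..<i}" by auto
  ultimately show ?thesis by (simp add: card_Diff_subset finite_subset)
qed

lemma ladder_le:
  assumes "i < n"
  shows "lo + ladder n0 k i \<le> \<alpha> (\<pi> i)"
proof -
  have "card {l. l < i \<and> tight l} \<le> n0"
    using assms by (intro card_positions_le) (auto simp: tight_def)
  with step_count_le[OF assms] card_not_tight[of i] show ?thesis unfolding ladder_eq by linarith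
qed

lemma ladder_less:
  assumes "i < n" "\<pi> i < i" "\<pi> i < n0"
  shows "lo + ladder n0 k i < \<alpha> (\<pi> i)"
proof -
  have "card (insert i {l. l < i \<and> tight l}) \<le> n0"
    using assms by (intro card_positions_le) (auto simp: tight_def)
  then have "card {l. l < i \<and> tight l} < n0" by simp
  moreover have "\<exists>l<i. \<not> tight l"
  proof (rule ccontr)
    assume "\<not> ?thesis"
    then have "l \<le> i \<Longrightarrow> l \<le> \<pi> l" for l
      by (induction l) (auto simp: tight_def Suc_le_eq intro: le_less_trans)
    with assms(2) show False by (meson le_refl not_less)
  qed
  then have "card {l. l < i \<and> \<not> tight l} > 0" by (auto simp: card_gt_0_iff)
  ultimately show ?thesis
    using step_count_le[OF assms(1)] card_not_tight[of i] unfolding ladder_eq by linarith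
qed

end

context
  fixes b :: nat
  assumes in_grid: "\<And>j. j < n \<Longrightarrow> \<alpha> j \<in> grid n n0 k b j"
begin

lemma le_ladder: "i < n \<Longrightarrow> \<alpha> (\<pi> i) \<le> b + ladder n0 k i"
proof (induction "n - Suc i" arbitrary: i)
  case 0
  then have "n = Suc i" by simp
  with 0 show ?case
    using grid_le_ladder[OF in_grid] grid_le_ladder_n[OF in_grid] sorting_less[of i] by blast
next
  case (Suc x)
  then have "Suc i < n" "x = n - Suc (Suc i)" by auto
  then have "\<alpha> (\<pi> i) + gap n0 k (\<pi> i) \<le> b + ladder n0 k (Suc i)"
    using gap_le[of i] Suc.hyps(1)[of "Suc i"] by linarith
  with Suc.prems show ?case
    using grid_le_ladder[OF in_grid] sorting_less by blast
qed

lemma eq_ladder_if_ge: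
  assumes b_le: "\<And>j. j < n \<Longrightarrow> b \<le> \<alpha> j" and "j < n"
  shows "\<alpha> j = b + ladder n0 k j"
proof -
  have on_ladder: "\<alpha> (\<pi> i) = b + ladder n0 k i" if "i < n" for i
    using le_ladder[OF that] ladder_le[OF b_le that] by simp
  have "\<pi> i < \<pi> (Suc i)" if "Suc i < n" for i
  proof (rule ccontr)
    assume descent: "\<not> \<pi> i < \<pi> (Suc i)"
    have "gap n0 k (\<pi> (Suc i)) < gap n0 k i"
      using gap_less_at_descent[OF that descent] on_ladder[of i] on_ladder[of "Suc i"] that
      by (simp add: ladder_Suc)
    then have "n0 \<le> i" "\<pi> (Suc i) < n0" by (auto simp: gap_def split: if_splits)
    have "tight l" if "l < n0" for l
      using step_le[of l] on_ladder[of l] on_ladder[of "Suc l"] that \<open>n0 \<le> i\<close> \<open>Suc i < n\<close>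
      by (simp add: ladder_Suc gap_def)
    then have "card (insert (Suc i) {..<n0}) \<le> n0"
      using \<open>\<pi> (Suc i) < n0\<close> \<open>n0 \<le> i\<close> that by (intro card_positions_le) (auto simp: tight_def)
    with \<open>n0 \<le> i\<close> show False by simp
  qed
  then have "\<pi> j = j"
    using bij \<open>j < n\<close> by (intro increasing_bij_betw_lessThan_eq)
  with on_ladder[OF \<open>j < n\<close>] show ?thesis by simp
qed

end

end

lemma spread_sortable:
  assumes "spread n (gap n0 k) \<alpha>"
  obtains \<pi> where "sorted_spread n n0 k \<alpha> \<pi>"
  using ex_lex_sorting[of n \<alpha>] assms by (metis sorted_spread.intro)

section \<open>Products over the grid\<close>

lemma levels_bounds:
  assumes "\<sigma> \<in> levels n n0 k j"
  shows "ladder n0 k j + gap n0 k j < \<sigma>" "\<sigma> \<le> ladder n0 k n"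
  using assms by (auto simp: levels_def ladder_Suc)

lemma finite_levels [simp]: "finite (levels n n0 k j)"
  by (simp add: levels_def)

lemma levels_Suc:
  assumes "j < n"
  shows "levels (Suc n) n0 k j = levels n n0 k j \<union> (\<lambda>s. ladder n0 k n + Suc s) ` {..<gap n0 k j}"
    (is "?L = ?R")
proof (intro set_eqI)
  fix \<sigma>
  have ladder_Suc_j_le: "ladder n0 k (Suc j) \<le> ladder n0 k n" using assms by (intro ladder_mono) simp
  show "\<sigma> \<in> ?L \<longleftrightarrow> \<sigma> \<in> ?R"
  proof (cases "\<sigma> \<le> ladder n0 k n")
    case True
    have "ladder n0 k n < ladder n0 k (Suc n)" if "n0 \<le> n"
      using that by (intro ladder_strict_mono) auto
    with True have "\<sigma> \<in> ladder n0 k ` {n0<..Suc n} \<longleftrightarrow> \<sigma> \<in> ladder n0 k ` {n0<..n}"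
      by (auto simp: le_Suc_eq)
    with True show ?thesis by (auto simp: levels_def ladder_Suc[of _ _ n])
  next
    case False
    have "\<sigma> \<notin> ladder n0 k ` {n0<..n}" using False ladder_mono[of _ n n0 k] by auto
    then have "\<sigma> \<in> ladder n0 k ` {n0<..Suc n} \<longleftrightarrow> n0 \<le> n \<and> \<sigma> = ladder n0 k (Suc n)"
      by (auto simp: le_Suc_eq)
    then have "\<sigma> \<in> ?L \<longleftrightarrow> \<sigma> \<le> ladder n0 k n + gap n0 k j"
      using False ladder_Suc_j_le assms by (auto simp: levels_def ladder_Suc[of _ _ n] gap_def)
    also have "\<dots> \<longleftrightarrow> \<sigma> \<in> ?R"
    proof -
      have "\<sigma> = ladder n0 k n + Suc (\<sigma> - Suc (ladder n0 k n))" using False by simp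
      moreover have "\<sigma> \<notin> levels n n0 k j" using False by (simp add: levels_def)
      ultimately show ?thesis by (auto simp: image_iff)
    qed
    finally show ?thesis .
  qed
qed

lemma (in comm_monoid_set) levels_blocks:
  assumes "j < n"
  shows "F g (levels n n0 k j) = F (\<lambda>l. F (\<lambda>s. g (ladder n0 k l + Suc s)) {..<gap n0 k j}) {Suc j..<n}"
proof -
  have "Suc j \<le> n" using assms by simp
  then show ?thesis
  proof (induction n rule: dec_induct)
    case base
    then show ?case by (simp add: levels_def)
  next
    case (step n)
    have "F g (levels (Suc n) n0 k j) =
        F g (levels n n0 k j) \<^bold>* F g ((\<lambda>s. ladder n0 k n + Suc s) ` {..<gap n0 k j})"
      using step(1) by (subst levels_Suc) (auto intro!: union_disjoint dest: levels_bounds)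
    also have "F g ((\<lambda>s. ladder n0 k n + Suc s) ` {..<gap n0 k j}) =
        F (\<lambda>s. g (ladder n0 k n + Suc s)) {..<gap n0 k j}"
      by (subst reindex) (auto simp: inj_on_def comp_def)
    finally show ?case using step by simp
  qed
qed

lemma grid_diff_ladder_eq:
  "grid n n0 k b j - {b + ladder n0 k j} =
     {..<b + ladder n0 k j} \<union> (\<lambda>\<sigma>. b + \<sigma> - gap n0 k j) ` levels n n0 k j"
  by (auto simp: grid_def dest: levels_bounds)

lemma (in comm_monoid_set) grid_diff_ladder:
  "F g (grid n n0 k b j - {b + ladder n0 k j}) =
     F g {..<b + ladder n0 k j} \<^bold>* F (\<lambda>\<sigma>. g (b + \<sigma> - gap n0 k j)) (levels n n0 k j)"
proof -
  have "inj_on (\<lambda>\<sigma>. b + \<sigma> - gap n0 k j) (levels n n0 k j)"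
    by (rule inj_onI) (auto dest!: levels_bounds(1))
  then show ?thesis
    unfolding grid_diff_ladder_eq
    by (subst union_disjoint) (auto simp: reindex comp_def dest: levels_bounds)
qed

lemma ladder_in_grid: "b + ladder n0 k j \<in> grid n n0 k b j"
  by (simp add: grid_def)

lemma card_grid:
  assumes "j < n"
  shows "card (grid n n0 k b j) = Suc (pole_order n b (gap n0 k) j)"
proof -
  have "card (grid n n0 k b j - {b + ladder n0 k j}) = b + ladder n0 k j + (n - Suc j) * gap n0 k j"
    unfolding card_eq_sum sum.grid_diff_ladder sum.levels_blocks[OF assms] by simp
  moreover have "finite (grid n n0 k b j)" by (simp add: grid_def)
  ultimately show ?thesis
    using ladder_in_grid[of b n0 k j n] card_Suc_Diff1[of "grid n n0 k b j"]
    by (simp add: pole_order_def ladder_def)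
qed

lemma prod_lessThan_ladder:
  fixes f :: "nat \<Rightarrow> 'a::comm_monoid_mult"
  shows "(\<Prod>\<gamma><b + ladder n0 k j. f \<gamma>) =
    (\<Prod>s<b. f s) * (\<Prod>i<j. \<Prod>s<gap n0 k i. f (b + ladder n0 k i + s))"
  by (induction j) (simp_all add: ladder_Suc prod_lessThan_add mult.assoc flip: add.assoc)

section \<open>Evaluation at powers of a generic base\<close>

locale generic_base =
  fixes q :: "'a::field"
  assumes nonzero [simp]: "q \<noteq> 0" and power_neq_1: "0 < N \<Longrightarrow> q ^ N \<noteq> 1"
begin

abbreviation qfac :: "nat \<Rightarrow> 'a" where
  "qfac N \<equiv> qpoch q q N"

lemma power_eq_iff: "q ^ i = q ^ j \<longleftrightarrow> i = j"
proof (induction i j rule: linorder_wlog)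
  case (le i j)
  then have "q ^ j = q ^ i * q ^ (j - i)" by (simp flip: power_add)
  with power_neq_1[of "j - i"] le show ?case by (cases "i = j") auto
qed auto

lemma one_minus_power_nonzero: "0 < N \<Longrightarrow> 1 - q ^ N \<noteq> 0"
  using power_neq_1[of N] by simp

lemma qfac_Suc: "qfac (Suc N) = qfac N * (1 - q ^ Suc N)"
  by (simp add: qpoch_def)

lemma qfac_0 [simp]: "qfac 0 = 1"
  by (simp add: qpoch_def)

lemma qfac_nonzero [simp]: "qfac N \<noteq> 0"
  using one_minus_power_nonzero[of "Suc _"] by (simp add: qpoch_def)

lemma qfac_add: "qfac (N + r) = qfac N * (\<Prod>s<r. 1 - q ^ (N + Suc s))"
  by (induction r) (simp_all add: qfac_Suc)

lemma qpoch_q_power: "qpoch q (q * q ^ N) r = qfac (N + r) / qfac N"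
proof -
  have "qpoch q (q * q ^ N) r = (\<Prod>s<r. 1 - q ^ (N + Suc s))"
    by (simp add: qpoch_def power_add mult_ac)
  then show ?thesis by (simp add: qfac_add)
qed

lemma prod_one_minus_power_diff:
  assumes "e \<le> u" "u \<le> w"
  shows "(\<Prod>\<sigma>\<in>{u<..w}. 1 - q ^ (\<sigma> - e)) = qfac (w - e) / qfac (u - e)"
  using assms(2)
proof (induction w rule: dec_induct)
  case (step w)
  then have "{u<..Suc w} = insert (Suc w) {u<..w}" "Suc w - e = Suc (w - e)" using assms(1) by auto
  with step show ?case by (simp add: qfac_Suc)
qed simp

lemma qpoch_quotient_eq_0:
  assumes "u \<le> w" "w < u + r"
  shows "qpoch q (q ^ u / q ^ w) r = 0"
proof -
  have "q ^ w = q ^ u * q ^ (w - u)" using assms by (simp flip: power_add)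
  then have "1 - q ^ u / q ^ w * q ^ (w - u) = 0" by simp
  moreover have "w - u \<in> {..<r}" using assms by auto
  ultimately show ?thesis unfolding qpoch_def by (intro prod_zero) auto
qed

lemma qpoch_q_quotient_eq_0:
  assumes "w < u" "u \<le> w + r"
  shows "qpoch q (q * (q ^ w / q ^ u)) r = 0"
  using qpoch_quotient_eq_0[of "Suc w" u r] assms by simp

lemma cross_nonzero_imp_spread:
  assumes nonzero: "cross q n \<beta> y \<noteq> 0" and y_eq: "\<And>j. j < n \<Longrightarrow> y j = q ^ \<alpha> j"
  shows "spread n \<beta> \<alpha>"
  unfolding spread_def
proof (intro allI impI)
  fix i j assume "i < j" "j < n"
  then have "qpoch q (q ^ \<alpha> i / q ^ \<alpha> j) (\<beta> i) \<noteq> 0"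
    "qpoch q (q * (q ^ \<alpha> j / q ^ \<alpha> i)) (\<beta> i) \<noteq> 0"
    using nonzero by (auto simp: cross_def simp del: times_divide_eq_right simp flip: y_eq)
  then show "if \<alpha> i \<le> \<alpha> j then \<alpha> i + \<beta> i \<le> \<alpha> j else \<alpha> j + \<beta> i < \<alpha> i"
    using qpoch_quotient_eq_0[of "\<alpha> i" "\<alpha> j" "\<beta> i"] qpoch_q_quotient_eq_0[of "\<alpha> j" "\<alpha> i" "\<beta> i"]
    by (metis not_le)
qed

lemma x0_factor_dvd:
  assumes "\<alpha> \<le> b + c" "c + r \<le> \<alpha> + A"
  shows "(\<Prod>s<r. [:- (q ^ (c + Suc s)), 1:]) dvd x0_factor q b A (q ^ \<alpha>)"
proof (rule prod_linear_dvd)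
  show "inj_on (\<lambda>s. q ^ (c + Suc s)) {..<r}"
    by (simp add: inj_on_def power_eq_iff del: power_Suc add_Suc_right)
  fix s assume s_less: "s \<in> {..<r}"
  define \<gamma> where "\<gamma> = c + Suc s"
  have "qpoch q (q ^ \<gamma> / q ^ \<alpha>) b = 0 \<or> qpoch q (q * (q ^ \<alpha> / q ^ \<gamma>)) A = 0"
  proof (cases "\<gamma> \<le> \<alpha>")
    case True
    then show ?thesis
      using assms s_less by (intro disjI1 qpoch_quotient_eq_0) (auto simp: \<gamma>_def)
  next
    case False
    then show ?thesis
      using assms s_less by (intro disjI2 qpoch_q_quotient_eq_0) (auto simp: \<gamma>_def)
  qed
  then show "poly (x0_factor q b A (q ^ \<alpha>)) (q ^ (c + Suc s)) = 0"
    unfolding \<gamma>_def[symmetric] by (subst poly_x0_factor) auto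
qed simp

definition ladder_roots :: "nat \<Rightarrow> nat \<Rightarrow> nat \<Rightarrow> (nat \<Rightarrow> nat) \<Rightarrow> 'a poly" where
  "ladder_roots n n0 k A = (\<Prod>i<n. \<Prod>s<A i. [:- (q ^ (ladder n0 k i + Suc s)), 1:])"

lemma degree_ladder_roots: "degree (ladder_roots n n0 k A) = (\<Sum>i<n. A i)"
  by (simp add: ladder_roots_def degree_prod_eq_sum_degree)

lemma lead_coeff_ladder_roots: "lead_coeff (ladder_roots n n0 k A) = 1"
  by (simp add: ladder_roots_def lead_coeff_prod)

lemma poly_ladder_roots_1:
  "poly (ladder_roots n n0 k A) 1 = (\<Prod>i<n. qfac (ladder n0 k i + A i) / qfac (ladder n0 k i))"
  by (simp add: ladder_roots_def poly_prod qfac_add)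

definition nodes :: "nat \<Rightarrow> nat \<Rightarrow> nat \<Rightarrow> nat \<Rightarrow> nat \<Rightarrow> 'a set" where
  "nodes n n0 k b j = (^) q ` grid n n0 k b j"

lemma inj_on_power: "inj_on ((^) q) T"
  by (simp add: inj_on_def power_eq_iff)

lemma card_nodes:
  "j < n \<Longrightarrow> card (nodes n n0 k b j) = Suc (pole_order n b (gap n0 k) j)"
  by (simp add: nodes_def card_image inj_on_power card_grid)

lemma finite_nodes: "finite (nodes n n0 k b j)"
  by (simp add: nodes_def grid_def)

lemma nodes_nonzero: "0 \<notin> nodes n n0 k b j"
  by (auto simp: nodes_def)

lemma cross_nonzero_sortable:
  assumes y_nodes: "y \<in> PiE {..<n} (nodes n n0 k b)" and cross: "cross q n (gap n0 k) y \<noteq> 0"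
  obtains \<alpha> \<pi> where "\<And>j. j < n \<Longrightarrow> y j = q ^ \<alpha> j" "\<And>j. j < n \<Longrightarrow> \<alpha> j \<in> grid n n0 k b j"
    "sorted_spread n n0 k \<alpha> \<pi>"
proof -
  have "\<forall>j\<in>{..<n}. \<exists>\<gamma>. \<gamma> \<in> grid n n0 k b j \<and> y j = q ^ \<gamma>"
    using y_nodes by (auto simp: nodes_def PiE_iff)
  then obtain \<alpha> where exponents: "\<And>j. j < n \<Longrightarrow> \<alpha> j \<in> grid n n0 k b j" "\<And>j. j < n \<Longrightarrow> y j = q ^ \<alpha> j"
    by (metis lessThan_iff)
  obtain \<pi> where "sorted_spread n n0 k \<alpha> \<pi>"
    using spread_sortable cross_nonzero_imp_spread[OF cross exponents(2)] by blast
  with exponents that show thesis by blast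
qed

lemma ladder_roots_dvd:
  assumes y_nodes: "y \<in> PiE {..<n} (nodes n n0 k b)" and cross: "cross q n (gap n0 k) y \<noteq> 0"
    and "r \<le> n0" and A_eq: "\<And>j. A j = a + of_bool (r \<le> j)"
  shows "ladder_roots n n0 k A dvd (\<Prod>j<n. x0_factor q b (A j) (y j))"
proof -
  obtain \<alpha> \<pi> where exponents: "\<And>j. j < n \<Longrightarrow> y j = q ^ \<alpha> j" "\<And>j. j < n \<Longrightarrow> \<alpha> j \<in> grid n n0 k b j"
    and sorted: "sorted_spread n n0 k \<alpha> \<pi>"
    using cross_nonzero_sortable[OF y_nodes cross] by blast
  interpret sorted_spread n n0 k \<alpha> \<pi> by (rule sorted)
  have "ladder n0 k i + A i \<le> \<alpha> (\<pi> i) + A (\<pi> i)" if "i < n" for i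
    using ladder_le[of 0 i] ladder_less[of 0 i] that \<open>r \<le> n0\<close> by (auto simp: A_eq)
  then have "(\<Prod>s<A i. [:- (q ^ (ladder n0 k i + Suc s)), 1:]) dvd x0_factor q b (A (\<pi> i)) (q ^ \<alpha> (\<pi> i))"
    if "i < n" for i
    using that le_ladder[OF exponents(2)] by (intro x0_factor_dvd) auto
  then have "ladder_roots n n0 k A dvd (\<Prod>i<n. x0_factor q b (A (\<pi> i)) (y (\<pi> i)))"
    unfolding ladder_roots_def using exponents(1) sorting_less by (intro prod_dvd_prod) simp
  also have "\<dots> = (\<Prod>j<n. x0_factor q b (A j) (y j))"
    by (rule prod.reindex_bij_betw[OF bij])
  finally show ?thesis .
qed

lemma ladder_roots_dvd_interpolant:
  assumes "r \<le> n0" "\<And>j. A j = a + of_bool (r \<le> j)"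
  shows "ladder_roots n n0 k A dvd interpolant q n b A (gap n0 k) (nodes n n0 k b)"
  unfolding interpolant_def
proof (rule dvd_sum)
  fix y assume "y \<in> PiE {..<n} (nodes n n0 k b)"
  note dvd = ladder_roots_dvd[OF this _ assms]
  show "ladder_roots n n0 k A dvd
      smult (grid_weight n (pole_order n b (gap n0 k)) (nodes n n0 k b) y * cross q n (gap n0 k) y)
        (\<Prod>j<n. x0_factor q b (A j) (y j))"
    using dvd by (cases "cross q n (gap n0 k) y = 0") (auto intro: dvd_smult)
qed

lemma contributing_at_1_imp_eq_ladder:
  assumes y_nodes: "y \<in> PiE {..<n} (nodes n n0 k b)" and cross: "cross q n (gap n0 k) y \<noteq> 0"
    and nonzero_at_1: "poly (\<Prod>j<n. x0_factor q b (A j) (y j)) 1 \<noteq> 0"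
  shows "y = (\<lambda>j\<in>{..<n}. q ^ (b + ladder n0 k j))"
proof -
  obtain \<alpha> \<pi> where exponents: "\<And>j. j < n \<Longrightarrow> y j = q ^ \<alpha> j" "\<And>j. j < n \<Longrightarrow> \<alpha> j \<in> grid n n0 k b j"
    and sorted: "sorted_spread n n0 k \<alpha> \<pi>"
    using cross_nonzero_sortable[OF y_nodes cross] by blast
  have "b \<le> \<alpha> j" if "j < n" for j
  proof (rule ccontr)
    assume "\<not> b \<le> \<alpha> j"
    then have "qpoch q (q ^ 0 / q ^ \<alpha> j) b = 0" by (intro qpoch_quotient_eq_0) auto
    with nonzero_at_1 that show False by (auto simp: poly_prod poly_x0_factor exponents(1))
  qed
  with exponents have "y j = q ^ (b + ladder n0 k j)" if "j < n" for j
    using sorted_spread.eq_ladder_if_ge[OF sorted exponents(2)] that by metis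
  with y_nodes show ?thesis by (auto simp: PiE_iff extensional_def fun_eq_iff)
qed

lemma lagrange_weight_nodes:
  "lagrange_weight d (nodes n n0 k b j) (q ^ (b + ladder n0 k j)) = (q ^ (b + ladder n0 k j)) ^ d /
     ((\<Prod>\<gamma><b + ladder n0 k j. q ^ (b + ladder n0 k j) - q ^ \<gamma>) *
      (\<Prod>\<sigma>\<in>levels n n0 k j. q ^ (b + ladder n0 k j) - q ^ (b + \<sigma> - gap n0 k j)))"
proof -
  have "nodes n n0 k b j - {q ^ (b + ladder n0 k j)} = (^) q ` (grid n n0 k b j - {b + ladder n0 k j})"
    by (auto simp: nodes_def power_eq_iff)
  then show ?thesis
    by (simp add: lagrange_weight_def prod.reindex inj_on_power prod.grid_diff_ladder)
qed

section \<open>Cancellation and telescoping at \<open>x\<^sub>0 = 1\<close>\<close>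

definition ladder_ratio :: "nat \<Rightarrow> nat \<Rightarrow> nat \<Rightarrow> nat \<Rightarrow> 'a" where
  "ladder_ratio n0 k j \<sigma> = (1 - q ^ (\<sigma> - ladder n0 k j)) / (1 - q ^ (\<sigma> - ladder n0 k (Suc j)))"

definition level_product :: "nat \<Rightarrow> nat \<Rightarrow> nat \<Rightarrow> 'a" where
  "level_product n n0 k = (\<Prod>j<n. \<Prod>\<sigma>\<in>levels n n0 k j. ladder_ratio n0 k j \<sigma>)"

lemma diff_quotient_eq_ladder_ratio:
  assumes "\<sigma> \<in> levels n n0 k j"
  shows "(q ^ (b + ladder n0 k j) - q ^ (b + \<sigma>)) /
      (q ^ (b + ladder n0 k j) - q ^ (b + \<sigma> - gap n0 k j)) =
    ladder_ratio n0 k j \<sigma>"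
proof -
  obtain e where "\<sigma> = ladder n0 k j + gap n0 k j + e"
    using levels_bounds(1)[OF assms] less_imp_add_positive by metis
  then have "q ^ (b + ladder n0 k j) - q ^ (b + \<sigma>) =
      q ^ (b + ladder n0 k j) * (1 - q ^ (\<sigma> - ladder n0 k j))"
    "q ^ (b + ladder n0 k j) - q ^ (b + \<sigma> - gap n0 k j) =
      q ^ (b + ladder n0 k j) * (1 - q ^ (\<sigma> - ladder n0 k (Suc j)))"
    by (simp_all add: ladder_Suc power_add algebra_simps)
  then show ?thesis by (simp add: ladder_ratio_def)
qed

lemma cleared_row_on_ladder:
  fixes n n0 k b :: nat
  defines "X \<equiv> \<lambda>j. q ^ (b + ladder n0 k j)"
  assumes "j < n"
  shows "(\<Prod>s<b. X j - q ^ s) * (\<Prod>i<j. \<Prod>s<gap n0 k i. X j - q ^ s * X i) *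
      (\<Prod>l=Suc j..<n. \<Prod>s<gap n0 k j. X j - q ^ Suc s * X l) =
    (\<Prod>\<gamma><b + ladder n0 k j. X j - q ^ \<gamma>) * (\<Prod>\<sigma>\<in>levels n n0 k j. X j - q ^ (b + \<sigma>))"
  unfolding prod_lessThan_ladder prod.levels_blocks[OF \<open>j < n\<close>]
  by (simp add: X_def power_add mult_ac)

lemma weight_times_cross_on_ladder:
  fixes n n0 k b :: nat
  defines "X \<equiv> \<lambda>j. q ^ (b + ladder n0 k j)"
  shows "grid_weight n (pole_order n b (gap n0 k)) (nodes n n0 k b) X * (\<Prod>j<n. qpoch q (1 / X j) b) *
    cross q n (gap n0 k) X = level_product n n0 k"
proof -
  define P where "P j = (\<Prod>\<gamma><b + ladder n0 k j. X j - q ^ \<gamma>)" for j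
  define D where "D j = (\<Prod>\<sigma>\<in>levels n n0 k j. X j - q ^ (b + \<sigma> - gap n0 k j))" for j
  have P_nonzero: "P j \<noteq> 0" for j by (auto simp: P_def X_def power_eq_iff)
  have "grid_weight n (pole_order n b (gap n0 k)) (nodes n n0 k b) X * (\<Prod>j<n. qpoch q (1 / X j) b) *
      cross q n (gap n0 k) X =
    (\<Prod>j<n. X j ^ pole_order n b (gap n0 k) j) * (\<Prod>j<n. qpoch q (1 / X j) b) *
      cross q n (gap n0 k) X / (\<Prod>j<n. P j * D j)"
    unfolding grid_weight_def X_def lagrange_weight_nodes P_def D_def by (simp add: prod_dividef)
  also have "\<dots> = (\<Prod>j<n. (\<Prod>s<b. X j - q ^ s) * (\<Prod>i<j. \<Prod>s<gap n0 k i. X j - q ^ s * X i) *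
       (\<Prod>l=Suc j..<n. \<Prod>s<gap n0 k j. X j - q ^ Suc s * X l) / (P j * D j))"
    unfolding prod_dividef by (subst clear_denominators) (simp_all add: X_def)
  also have "\<dots> = (\<Prod>j<n. P j * (\<Prod>\<sigma>\<in>levels n n0 k j. X j - q ^ (b + \<sigma>)) / (P j * D j))"
    unfolding X_def P_def by (intro prod.cong refl) (simp only: cleared_row_on_ladder lessThan_iff)
  also have "\<dots> = (\<Prod>j<n. \<Prod>\<sigma>\<in>levels n n0 k j.
      (X j - q ^ (b + \<sigma>)) / (X j - q ^ (b + \<sigma> - gap n0 k j)))"
    using P_nonzero by (simp add: D_def prod_dividef)
  also have "\<dots> = level_product n n0 k"
    unfolding level_product_def X_def by (intro prod.cong refl diff_quotient_eq_ladder_ratio)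
  finally show ?thesis .
qed

lemma poly_interpolant_1:
  "poly (interpolant q n b A (gap n0 k) (nodes n n0 k b)) 1 =
     level_product n n0 k * (\<Prod>j<n. qfac (b + ladder n0 k j + A j) / qfac (b + ladder n0 k j))"
proof -
  define X where "X = (\<lambda>j. q ^ (b + ladder n0 k j))"
  define y0 where "y0 = restrict X {..<n}"
  define W where "W y = grid_weight n (pole_order n b (gap n0 k)) (nodes n n0 k b) y *
      cross q n (gap n0 k) y * poly (\<Prod>j<n. x0_factor q b (A j) (y j)) 1" for y
  have "y0 \<in> PiE {..<n} (nodes n n0 k b)"
    by (auto simp: y0_def X_def nodes_def ladder_in_grid)
  moreover have "W y = 0" if "y \<in> PiE {..<n} (nodes n n0 k b)" "y \<noteq> y0" for y
    using contributing_at_1_imp_eq_ladder[OF that(1), of A] that(2)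
    unfolding W_def y0_def X_def mult_eq_0_iff by blast
  ultimately have "poly (interpolant q n b A (gap n0 k) (nodes n n0 k b)) 1 = W y0"
    using sum.mono_neutral_right[of "PiE {..<n} (nodes n n0 k b)" "{y0}" W]
    by (simp add: interpolant_def poly_sum W_def finite_PiE finite_nodes)
  also have "\<dots> = grid_weight n (pole_order n b (gap n0 k)) (nodes n n0 k b) X *
      (\<Prod>j<n. qpoch q (1 / X j) b) * cross q n (gap n0 k) X * (\<Prod>j<n. qpoch q (q * X j) (A j))"
    by (simp add: W_def y0_def cross_restrict grid_weight_def poly_prod poly_x0_factor prod.distrib
        mult_ac)
  also have "\<dots> = level_product n n0 k *
      (\<Prod>j<n. qfac (b + ladder n0 k j + A j) / qfac (b + ladder n0 k j))"
    unfolding X_def weight_times_cross_on_ladder qpoch_q_power ..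
  finally show ?thesis .
qed

lemma prod_ladder_ratio_interval:
  assumes "j < n"
  shows "(\<Prod>\<sigma>\<in>{ladder n0 k (Suc j)<..ladder n0 k n}. ladder_ratio n0 k j \<sigma>) =
    qfac (ladder n0 k n - ladder n0 k j) /
      qfac (ladder n0 k n - ladder n0 k (Suc j)) / qfac (gap n0 k j)"
proof -
  have "ladder n0 k j \<le> ladder n0 k (Suc j)" "ladder n0 k (Suc j) \<le> ladder n0 k n"
    using assms by (auto intro!: ladder_mono)
  then have "(\<Prod>\<sigma>\<in>{ladder n0 k (Suc j)<..ladder n0 k n}. 1 - q ^ (\<sigma> - ladder n0 k j)) =
      qfac (ladder n0 k n - ladder n0 k j) / qfac (ladder n0 k (Suc j) - ladder n0 k j)"
    "(\<Prod>\<sigma>\<in>{ladder n0 k (Suc j)<..ladder n0 k n}. 1 - q ^ (\<sigma> - ladder n0 k (Suc j))) =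
      qfac (ladder n0 k n - ladder n0 k (Suc j))"
    by (simp_all add: prod_one_minus_power_diff)
  then show ?thesis by (simp add: ladder_ratio_def prod_dividef ladder_Suc)
qed

lemma prod_ladder_ratio_levels:
  assumes "j < n"
  shows "(\<Prod>\<sigma>\<in>levels n n0 k j. ladder_ratio n0 k j \<sigma>) =
    qfac (ladder n0 k n - ladder n0 k j) /
      qfac (ladder n0 k n - ladder n0 k (Suc j)) / qfac (gap n0 k j) *
    (if j < n0 then \<Prod>i\<in>{n0<..n}. 1 / ladder_ratio n0 k j (ladder n0 k i) else 1)"
proof (cases "j < n0")
  case True
  have ladder_greater: "ladder n0 k (Suc j) < ladder n0 k i" if "n0 < i" for i
    using ladder_strict_mono[of "Suc j" i n0 k] that True by simp
  have ratio_nonzero: "ladder_ratio n0 k j (ladder n0 k i) \<noteq> 0" if "n0 < i" for i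
    using ladder_greater[OF that] one_minus_power_nonzero[of "ladder n0 k i - ladder n0 k (Suc j)"]
      one_minus_power_nonzero[of "ladder n0 k i - ladder n0 k j"]
    by (simp add: ladder_ratio_def ladder_Suc)
  have "strict_mono_on {n0<..n} (ladder n0 k)"
    by (auto intro!: strict_mono_onI ladder_strict_mono)
  then have "inj_on (ladder n0 k) {n0<..n}" by (rule strict_mono_on_imp_inj_on)
  moreover have "ladder n0 k ` {n0<..n} \<subseteq> {ladder n0 k (Suc j)<..ladder n0 k n}"
    using ladder_greater by (auto intro: ladder_mono)
  ultimately have "(\<Prod>\<sigma>\<in>{ladder n0 k (Suc j)<..ladder n0 k n}. ladder_ratio n0 k j \<sigma>) =
      (\<Prod>\<sigma>\<in>levels n n0 k j. ladder_ratio n0 k j \<sigma>) * (\<Prod>i\<in>{n0<..n}. ladder_ratio n0 k j (ladder n0 k i))"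
    using True
    by (subst prod.subset_diff[of "ladder n0 k ` {n0<..n}"]) (simp_all add: levels_def prod.reindex)
  moreover have "(\<Prod>i\<in>{n0<..n}. ladder_ratio n0 k j (ladder n0 k i)) \<noteq> 0"
    by (simp add: ratio_nonzero)
  ultimately have "(\<Prod>\<sigma>\<in>levels n n0 k j. ladder_ratio n0 k j \<sigma>) =
      (\<Prod>\<sigma>\<in>{ladder n0 k (Suc j)<..ladder n0 k n}. ladder_ratio n0 k j \<sigma>) *
      (\<Prod>i\<in>{n0<..n}. 1 / ladder_ratio n0 k j (ladder n0 k i))"
    by (simp add: prod_dividef)
  with True show ?thesis
    unfolding prod_ladder_ratio_interval[OF assms] by simp
next
  case False
  then show ?thesis by (simp add: levels_def prod_ladder_ratio_interval[OF assms])
qed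

lemma prod_inverse_ladder_ratio_telescope:
  assumes "n0 < i"
  shows "(\<Prod>j<n0. 1 / ladder_ratio n0 k j (ladder n0 k i)) =
    (1 - q ^ (ladder n0 k i - ladder n0 k n0)) / (1 - q ^ ladder n0 k i)"
proof -
  have "1 - q ^ (ladder n0 k i - ladder n0 k j) \<noteq> 0" if "j \<le> n0" for j
    using ladder_strict_mono[of j i n0 k] that assms by (intro one_minus_power_nonzero) auto
  then show ?thesis
    using prod_lessThan_telescope[of n0 "\<lambda>j. 1 - q ^ (ladder n0 k i - ladder n0 k j)"]
    by (simp add: ladder_ratio_def)
qed

lemma level_product_telescope:
  assumes "n0 \<le> n"
  shows "level_product n n0 k = qfac (ladder n0 k n) / (\<Prod>j<n. qfac (gap n0 k j)) *
    (\<Prod>i\<in>{n0<..n}. (1 - q ^ (ladder n0 k i - ladder n0 k n0)) / (1 - q ^ ladder n0 k i))"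
proof -
  have "level_product n n0 k =
      (\<Prod>j<n. qfac (ladder n0 k n - ladder n0 k j) / qfac (ladder n0 k n - ladder n0 k (Suc j))) /
      (\<Prod>j<n. qfac (gap n0 k j)) *
      (\<Prod>j<n. if j < n0 then \<Prod>i\<in>{n0<..n}. 1 / ladder_ratio n0 k j (ladder n0 k i) else 1)"
    unfolding level_product_def prod.distrib[symmetric] prod_dividef[symmetric]
    by (intro prod.cong refl prod_ladder_ratio_levels) simp
  also have "(\<Prod>j<n. qfac (ladder n0 k n - ladder n0 k j) / qfac (ladder n0 k n - ladder n0 k (Suc j))) =
      qfac (ladder n0 k n)"
    by (subst prod_lessThan_telescope') simp_all
  also have "(\<Prod>j<n. if j < n0 then \<Prod>i\<in>{n0<..n}. 1 / ladder_ratio n0 k j (ladder n0 k i) else 1) =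
      (\<Prod>j<n0. \<Prod>i\<in>{n0<..n}. 1 / ladder_ratio n0 k j (ladder n0 k i))"
    using assms by (intro prod.mono_neutral_cong_right) auto
  also have "\<dots> = (\<Prod>i\<in>{n0<..n}. (1 - q ^ (ladder n0 k i - ladder n0 k n0)) / (1 - q ^ ladder n0 k i))"
    by (subst prod.swap) (intro prod.cong refl prod_inverse_ladder_ratio_telescope, simp)
  finally show ?thesis .
qed

lemma prod_qfac_ladder_quotient:
  "(\<Prod>j<n. qfac (ladder n0 k j + k) / (qfac (ladder n0 k j) * qfac k)) =
    qfac (ladder n0 k n) / (\<Prod>j<n. qfac (gap n0 k j)) *
    (\<Prod>i\<in>{n0<..n}. (1 - q ^ (k + 1)) / (1 - q ^ ladder n0 k i))"
proof (induction n)
  case (Suc n)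
  show ?case
  proof (cases "n < n0")
    case True
    then have "{n0<..Suc n} = {n0<..n}" "gap n0 k n = k" by (auto simp: gap_def)
    then show ?thesis by (simp add: Suc ladder_Suc)
  next
    case False
    then have "{n0<..Suc n} = insert (Suc n) {n0<..n}" and gap_n: "gap n0 k n = Suc k"
      by (auto simp: gap_def)
    moreover have "qfac (ladder n0 k (Suc n)) =
        qfac (ladder n0 k n + k) * (1 - q ^ ladder n0 k (Suc n))"
      by (simp add: ladder_Suc gap_n qfac_Suc)
    moreover have "1 - q ^ ladder n0 k (Suc n) \<noteq> 0" "1 - q ^ Suc k \<noteq> 0"
      by (intro one_minus_power_nonzero; simp add: ladder_Suc gap_n)+
    ultimately show ?thesis
      by (simp add: Suc qfac_Suc[of k] del: power_Suc)
  qed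
qed simp

lemma level_product_eq:
  assumes "n0 \<le> n"
  shows "level_product n n0 k =
    (\<Prod>j<n. qfac (ladder n0 k j + k) / (qfac (ladder n0 k j) * qfac k)) *
    (\<Prod>j=1..n - n0. (1 - q ^ ((k + 1) * j)) / (1 - q ^ (k + 1)))"
proof -
  have "(\<Prod>j=1..n - n0. (1 - q ^ ((k + 1) * j)) / (1 - q ^ (k + 1))) =
      (\<Prod>i\<in>{n0<..n}. (1 - q ^ (ladder n0 k i - ladder n0 k n0)) / (1 - q ^ (k + 1)))"
    by (rule prod.reindex_bij_witness[where i = "\<lambda>i. i - n0" and j = "\<lambda>j. n0 + j"])
      (auto simp: ladder_eq algebra_simps)
  moreover have "1 - q ^ (k + 1) \<noteq> 0" by (intro one_minus_power_nonzero) simp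
  ultimately show ?thesis
    unfolding level_product_telescope[OF assms] prod_qfac_ladder_quotient
    by (simp add: mult.assoc del: power_Suc flip: prod.distrib)
qed

lemma coeff_interpolant:
  fixes n n0 k a b r :: nat
  defines "A \<equiv> \<lambda>j. a + of_bool (r \<le> j)"
  defines "g \<equiv> interpolant q n b A (gap n0 k) (nodes n n0 k b)"
  assumes "r \<le> n0" "n0 \<le> n" and degree: "degree g \<le> (\<Sum>j<n. A j)"
  shows "coeff g (\<Sum>j<n. A j) =
    (\<Prod>j<n. qfac (b + ladder n0 k j + A j) * qfac (ladder n0 k j + k) /
       (qfac (ladder n0 k j + A j) * qfac (b + ladder n0 k j) * qfac k)) *
    (\<Prod>j=1..n - n0. (1 - q ^ ((k + 1) * j)) / (1 - q ^ (k + 1)))"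
proof -
  have "ladder_roots n n0 k A dvd g"
    unfolding g_def using \<open>r \<le> n0\<close> by (rule ladder_roots_dvd_interpolant) (simp add: A_def)
  then have "g = smult (coeff g (\<Sum>j<n. A j)) (ladder_roots n n0 k A)"
    using monic_dvd_imp_eq_smult[of "ladder_roots n n0 k A" g] lead_coeff_ladder_roots degree
    by (simp add: degree_ladder_roots)
  then have "poly g 1 = coeff g (\<Sum>j<n. A j) * poly (ladder_roots n n0 k A) 1"
    by (metis poly_smult)
  moreover have "poly (ladder_roots n n0 k A) 1 \<noteq> 0" by (simp add: poly_ladder_roots_1)
  ultimately have "coeff g (\<Sum>j<n. A j) = poly g 1 / poly (ladder_roots n n0 k A) 1"
    by (simp add: eq_divide_eq)
  then show ?thesis
    unfolding g_def poly_interpolant_1 poly_ladder_roots_1 level_product_eq[OF \<open>n0 \<le> n\<close>]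
    by (simp add: prod_dividef prod.distrib mult_ac)
qed

end

lemma generic_base_q_ind: "generic_base q_ind"
proof
  show "q_ind \<noteq> 0"
    using one_minus_q_power_nonzero[of 1] by (simp add: q_ind_def Zero_fract_def eq_fract)
  show "q_ind ^ N \<noteq> 1" if "0 < N" for N
    using one_minus_q_power_nonzero[OF that] by simp
qed

theorem theorem7:
  fixes n a b k m n0 :: nat
    and B :: "nat \<Rightarrow> nat \<Rightarrow> nat"
  assumes "n > 0"
    and "m \<le> n" and "n0 \<le> n" and "n \<le> m + n0"
    and "\<And>i. i \<le> n \<Longrightarrow> B i i = 0"
    and "\<And>j. 1 \<le> j \<Longrightarrow> j \<le> n \<Longrightarrow> B 0 j = b"
    and "\<And>i. 1 \<le> i \<Longrightarrow> i \<le> n - m \<Longrightarrow> B i 0 = a"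
    and "\<And>i. n - m < i \<Longrightarrow> i \<le> n \<Longrightarrow> B i 0 = a + 1"
    and "\<And>i j. 1 \<le> i \<Longrightarrow> i \<le> n \<Longrightarrow> 1 \<le> j \<Longrightarrow> j \<le> n \<Longrightarrow> i \<noteq> j \<Longrightarrow>
           B i j = (if i > n0 \<and> j > n0 then k + 1 else k)"
  shows "CT (Lq n B) =
    (\<Prod>j = 0..<n.
       (qfact (a + b + k * j + of_bool (j > n0) * (j - n0) + of_bool (j \<ge> n - m)) *
        qfact (k * j + of_bool (j > n0) * (j - n0) + k)) /
       (qfact (a + k * j + of_bool (j > n0) * (j - n0) + of_bool (j \<ge> n - m)) *
        qfact (b + k * j + of_bool (j > n0) * (j - n0)) *
        qfact k)) *
    (\<Prod>j = 1..n - n0. (1 - q_ind ^ ((k + 1) * j)) / (1 - q_ind ^ (k + 1)))"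
proof -
  define A where "A j = a + of_bool (n - m \<le> j)" for j
  interpret exponent_matrix n b A "gap n0 k" B
    using assms(5-9) by unfold_locales (auto simp: A_def gap_def not_le less_Suc_eq_le)
  interpret q_ind: generic_base q_ind by (rule generic_base_q_ind)
  have ladder_closed_form: "ladder n0 k j = k * j + of_bool (j > n0) * (j - n0)" for j
    by (simp add: ladder_eq)
  have "CT (Lq n B) = coeff (interpolant q_ind n b A (gap n0 k) (q_ind.nodes n n0 k b)) (\<Sum>j<n. A j)"
    using q_ind.card_nodes q_ind.nodes_nonzero by (rule coeff_interpolant_eq_CT[symmetric])
  also have "\<dots> =
    (\<Prod>j<n. qfact (b + ladder n0 k j + A j) * qfact (ladder n0 k j + k) /
       (qfact (ladder n0 k j + A j) * qfact (b + ladder n0 k j) * qfact k)) *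
    (\<Prod>j=1..n - n0. (1 - q_ind ^ ((k + 1) * j)) / (1 - q_ind ^ (k + 1)))"
    unfolding A_def using assms(3,4) q_ind.card_nodes q_ind.nodes_nonzero
    by (intro q_ind.coeff_interpolant degree_interpolant_le[unfolded A_def]) auto
  finally show ?thesis
    unfolding A_def ladder_closed_form atLeast0LessThan by (simp only: add_ac)
qed

end
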